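(* Fix a real number $\lambda \in (0,1)$, and let $N, D$ range over positive integers with $N/D = \lambda$. For each such pair let $X \in \mathbb{R}^{N \times D}$ be a random matrix whose entries are independent $\mathcal{N}(0,1)$ random variables, let $\theta^* \in \mathbb{R}^D$ be a fixed (deterministic) vector, and let $\omega = (\omega_1,\dots,\omega_N) \in \mathbb{R}^N$ be a random vector, independent of $X$, with independent entries $\omega_i \sim \mathcal{N}(0,1)$. Set $y = X\theta^* + \omega$. Then, as $N, D \to \infty$ with $N/D = \lambda$ fixed, $$ \mathbb{E}_{X,\omega}\, \left\| X^{\dagger} y - X^{\dagger} X \theta^* \right\| = (1+o(1)) \sqrt{\frac{N}{D-N}}.$$
   Context: Here $\|\cdot\|$ is the Euclidean ($\ell^2$) norm on $\mathbb{R}^D$, and $X^{\dagger} = X^T (X X^T)^{-1} \in \mathbb{R}^{D \times N}$, which is well defined with probability $1$ since $N < D$ and $X$ is Gaussian. Equivalently, $X^{\dagger} y$ is the vector of smallest $\ell^2$-norm among the minimizers of $\theta \mapsto \|X\theta - y\|$ over $\theta \in \mathbb{R}^D$. The expectation $\mathbb{E}_{X,\omega}$ is over both $X$ and $\omega$, and $o(1)$ denotes a quantity tending to $0$ as $N, D \to \infty$ with $N/D = \lambda$ fixed. *)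

theory Defs
  imports
    "HOL-Probability.Probability"
    "HOL-Library.Landau_Symbols"
    "Jordan_Normal_Form.Gauss_Jordan_Elimination"
begin

(* Matrices and vectors come from Jordan_Normal_Form (dimensions are values, since N and D vary).
   The names below would otherwise be ambiguous with those of HOL-Analysis. *)
hide_const (open) Finite_Cartesian_Product.vec Finite_Cartesian_Product.mat
hide_type (open) Finite_Cartesian_Product.vec
no_notation Finite_Cartesian_Product.vec_nth (infixl \<open>$\<close> 90)

(* The value 0 on singular matrices is an arbitrary choice; X * X^T is almost surely invertible. *)
definition mat_inv :: "real mat \<Rightarrow> real mat" where
  "mat_inv A = (case mat_inverse A of Some B \<Rightarrow> B | None \<Rightarrow> 0\<^sub>m (dim_row A) (dim_row A))"

definition pinv :: "real mat \<Rightarrow> real mat" where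
  "pinv X = transpose_mat X * mat_inv (X * transpose_mat X)"

definition l2_norm :: "real vec \<Rightarrow> real" where
  "l2_norm v = L2_set (\<lambda>i. v $ i) {..<dim_vec v}"

definition iid_std_normal :: "'a measure \<Rightarrow> ('i \<Rightarrow> 'a \<Rightarrow> real) \<Rightarrow> 'i set \<Rightarrow> bool" where
  "iid_std_normal M Z I \<longleftrightarrow>
     prob_space.indep_vars M (\<lambda>_. borel) Z I \<and>
     (\<forall>i\<in>I. distributed M lborel (Z i) std_normal_density)"

definition gaussian_matrix :: "'a measure \<Rightarrow> nat \<Rightarrow> nat \<Rightarrow> ('a \<Rightarrow> real mat) \<Rightarrow> bool" where
  "gaussian_matrix M N D X \<longleftrightarrow>
     (\<forall>s\<in>space M. X s \<in> carrier_mat N D) \<and>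
     iid_std_normal M (\<lambda>(i, j) s. X s $$ (i, j)) ({..<N} \<times> {..<D})"

definition gaussian_vector :: "'a measure \<Rightarrow> nat \<Rightarrow> ('a \<Rightarrow> real vec) \<Rightarrow> bool" where
  "gaussian_vector M N w \<longleftrightarrow>
     (\<forall>s\<in>space M. w s \<in> carrier_vec N) \<and>
     iid_std_normal M (\<lambda>i s. w s $ i) {..<N}"

(* Independence of the sigma-algebras generated by X and w. The types of matrices and vectors carry
   no measurable-space structure, so these are generated by the entry families as random elements
   of product spaces; indep_var does not apply, as it needs both elements to have the same type. *)
definition indep_mat_vec ::
  "'a measure \<Rightarrow> nat \<Rightarrow> nat \<Rightarrow> ('a \<Rightarrow> real mat) \<Rightarrow> ('a \<Rightarrow> real vec) \<Rightarrow> bool" where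
  "indep_mat_vec M N D X w \<longleftrightarrow>
     prob_space.indep_set M
       (sets (vimage_algebra (space M) (\<lambda>s. \<lambda>(i, j)\<in>{..<N} \<times> {..<D}. X s $$ (i, j))
          (PiM ({..<N} \<times> {..<D}) (\<lambda>_. borel))))
       (sets (vimage_algebra (space M) (\<lambda>s. \<lambda>i\<in>{..<N}. w s $ i) (PiM {..<N} (\<lambda>_. borel))))"

definition ratio_pairs :: "real \<Rightarrow> (nat \<times> nat) set" where
  "ratio_pairs lam = {(N, D). 0 < N \<and> 0 < D \<and> real N / real D = lam}"

(* N and D tend to infinity along the pairs with N / D = lam; this is the trivial filter when
   lam is irrational, there being no such pairs. *)
definition ratio_filter :: "real \<Rightarrow> (nat \<times> nat) filter" where
  "ratio_filter lam = inf (at_top \<times>\<^sub>F at_top) (principal (ratio_pairs lam))"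

end

theory Submission
  imports Defs "Jordan_Normal_Form.Determinant" "HOL-Real_Asymp.Real_Asymp"
begin

text \<open>
The error is the norm V of X^+ w, where w is the noise, and c = sqrt (N / (D - N)) is its target.
Two moments pin V down to c. With A = X X^T, Gaussian integration by parts along a row of X gives
E (A^-1)_ii \<le> 1 / (D - N - 1), hence E V^2 = E tr A^-1 \<le> N / (D - N - 1). On the other hand
V^2 / (1 + V^2) is the leverage w^T (A + w w^T)^-1 w of the last column of the N by (D + 1) matrix [X | w];
the leverages of all columns add up to N and are exchangeable, hence E (V^2 / (1 + V^2)) = N / (D + 1).
Since V^2 / (1 + V^2) is strictly concave in V^2 and the two moments tend to c^2 and c^2 / (1 + c^2),
V concentrates at c. Both estimates are proved for the ridge-regularized A + e I, where all functions
involved are bounded and smooth; the first one then also shows that A is almost surely invertible,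
and e tends to 0.
\<close>

text \<open>The two moments look at the matrix in different directions: integration by parts runs
  along a row, a Gaussian vector with D entries, while the leverages belong to the columns. The
  constant D - N - 1 arises as (D - N + 1) - 2: the first term is the dimension left over by the
  other N - 1 rows, and 2 is lost in differentiating the quadratic form in a denominator. The ratio
  V^2 / (1 + V^2) enters because appending w as a further column makes its mean computable by
  symmetry alone.

  Each moment is estimated from one side only. This is enough because the lower bound for E V uses E
  V^2 with a nonpositive coefficient and the mean of the ratio with a nonnegative one, while the
  upper bound uses E V^2 alone.

  The obstacle is that A^-1 is unbounded near singular matrices, so that neither integrability nor
  integration by parts is available for it directly. For fixed e > 0 the derivatives involved are
  bounded by multiples of 1 / e, yet the resulting bounds on the expected inverse do not depend on
  e. In the leverage identity e appears only as a factor of a trace whose mean is bounded in this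
  way.\<close>

hide_const (open) Determinants.det
no_notation inner (infix \<open>\<bullet>\<close> 70)

section \<open>Ridge-regularized Gram matrices\<close>

text \<open>This includes the singular case, since 1 / 0 = 0.\<close>

lemma mat_inv_eq_adj_mat:
  assumes A: "A \<in> carrier_mat n n"
  shows "mat_inv A = (1 / det A) \<cdot>\<^sub>m adj_mat A"
proof (cases "mat_inverse A")
  case None
  then have "A \<notin> Units (ring_mat TYPE(real) n ())"
    using mat_inverse(1)[OF A, where b = "()"] by simp
  then have "det A = 0" using det_non_zero_imp_unit[OF A, where b = "()"] by blast
  then show ?thesis
    using A adj_mat(1)[OF A] None by (auto simp: mat_inv_def intro!: eq_matI)
next
  case (Some B)
  have B: "A * B = 1\<^sub>m n" "B * A = 1\<^sub>m n" "B \<in> carrier_mat n n"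
    using mat_inverse(2)[OF A Some] by auto
  have "det A * det B = 1" using B det_mult[OF A B(3)] by simp
  then have d: "det A \<noteq> 0" by auto
  have "adj_mat A = (adj_mat A * A) * B"
    using B(1) A B(3) adj_mat(1)[OF A] by (simp add: assoc_mult_mat[of _ n n _ n _ n])
  also have "\<dots> = det A \<cdot>\<^sub>m B"
    using adj_mat(3)[OF A] B(3) by (simp add: mult_smult_assoc_mat[of _ n n _ n])
  finally show ?thesis using Some d B(3) by (auto simp: mat_inv_def intro!: eq_matI)
qed

lemma mat_inv_carrier: "A \<in> carrier_mat n n \<Longrightarrow> mat_inv A \<in> carrier_mat n n"
  using mat_inv_eq_adj_mat adj_mat(1) by (metis smult_carrier_mat)

lemma mat_inv_inverse:
  assumes "A \<in> carrier_mat n n" "det A \<noteq> 0"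
  shows "A * mat_inv A = 1\<^sub>m n" "mat_inv A * A = 1\<^sub>m n"
  using assms adj_mat[OF assms(1)] 
  by (auto simp: mat_inv_eq_adj_mat mult_smult_distrib[of _ n n _ n] mult_smult_assoc_mat[of _ n n _ n] intro!: eq_matI)

lemma mat_inv_vec:
  assumes "A \<in> carrier_mat n n" "det A \<noteq> 0" "v \<in> carrier_vec n"
  shows "A *\<^sub>v (mat_inv A *\<^sub>v v) = v" "mat_inv A *\<^sub>v (A *\<^sub>v v) = v"
  using assms mat_inv_inverse[OF assms(1,2)] mat_inv_carrier[OF assms(1)]
  by (simp_all flip: assoc_mult_mat_vec[of _ n n _ n])

text \<open>At e = 0 this is the matrix inverted in \<open>pinv\<close> (see
  \<open>ridge_0\<close>), so identities that assume only a nonzero determinant serve both the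
  regularized and the limiting case.\<close>

definition ridge :: "real \<Rightarrow> real mat \<Rightarrow> real mat" where
  "ridge e X = X * transpose_mat X + e \<cdot>\<^sub>m 1\<^sub>m (dim_row X)"

lemma ridge_carrier: "X \<in> carrier_mat N D \<Longrightarrow> ridge e X \<in> carrier_mat N N"
  by (simp add: ridge_def)

lemma transpose_mult_scalar_prod:
  assumes "X \<in> carrier_mat N D" "u \<in> carrier_vec N" "v \<in> carrier_vec D"
  shows "(transpose_mat X *\<^sub>v u) \<bullet> v = u \<bullet> (X *\<^sub>v (v :: real vec))"
  using transpose_vec_mult_scalar[OF assms(1,3,2)] assms
  by (metis comm_scalar_prod mult_mat_vec_carrier transpose_carrier_mat)

lemma ridge_mult_vec:
  assumes "X \<in> carrier_mat N D" "z \<in> carrier_vec N"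
  shows "ridge e X *\<^sub>v z = X *\<^sub>v (transpose_mat X *\<^sub>v z) + e \<cdot>\<^sub>v z"
proof -
  have "(e \<cdot>\<^sub>m 1\<^sub>m N) *\<^sub>v z = e \<cdot>\<^sub>v z"
    using assms by (intro eq_vecI) (auto simp: row_smult)
  then show ?thesis
    using assms by (simp add: ridge_def add_mult_distrib_mat_vec[of _ N N] assoc_mult_mat_vec[of _ N D _ N])
qed

lemma ridge_0_mult_vec:
  assumes "X \<in> carrier_mat N D" "z \<in> carrier_vec N"
  shows "ridge 0 X *\<^sub>v z = X *\<^sub>v (transpose_mat X *\<^sub>v z)"
  using assms ridge_mult_vec[OF assms, of 0] by (auto intro!: eq_vecI)

lemma scalar_prod_ridge:
  assumes "X \<in> carrier_mat N D" "z \<in> carrier_vec N" "v \<in> carrier_vec N"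
  shows "v \<bullet> (ridge e X *\<^sub>v z) = (transpose_mat X *\<^sub>v v) \<bullet> (transpose_mat X *\<^sub>v z) + e * (v \<bullet> z)"
  using assms 
  by (simp add: ridge_mult_vec scalar_prod_add_distrib[of _ N] transpose_mult_scalar_prod)

lemma scalar_prod_self_nonneg: "0 \<le> v \<bullet> (v :: real vec)"
  by (auto simp: scalar_prod_def intro: sum_nonneg)

lemma scalar_prod_self_ge: "i < dim_vec v \<Longrightarrow> (v $ i)\<^sup>2 \<le> v \<bullet> (v :: real vec)"
  unfolding scalar_prod_def power2_eq_square
  by (rule member_le_sum) auto

lemma scalar_prod_self_eq_0: "v \<in> carrier_vec n \<Longrightarrow> v \<bullet> (v :: real vec) = 0 \<longleftrightarrow> v = 0\<^sub>v n"
proof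
  assume "v \<in> carrier_vec n" "v \<bullet> v = 0"
  then show "v = 0\<^sub>v n"
    by (intro eq_vecI) (use scalar_prod_self_ge[of _ v] in auto)
qed auto

text \<open>The quadratic form of the matrix at v is at least e |v|^2, so its kernel is
  trivial.\<close>

lemma det_ridge_nonzero:
  assumes X: "X \<in> carrier_mat N D" and e: "0 < e"
  shows "det (ridge e X) \<noteq> 0"
proof
  assume "det (ridge e X) = 0"
  then obtain v where v: "v \<in> carrier_vec N" "v \<noteq> 0\<^sub>v N" "ridge e X *\<^sub>v v = 0\<^sub>v N"
    using det_0_iff_vec_prod_zero ridge_carrier[OF X] by blast
  have "0 = v \<bullet> (ridge e X *\<^sub>v v)" using v by simp
  also have "\<dots> \<ge> e * (v \<bullet> v)"
    using scalar_prod_ridge[OF X v(1) v(1)] scalar_prod_self_nonneg by simp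
  finally have "v \<bullet> v \<le> 0" using e by (simp add: mult_le_0_iff)
  then show False using v scalar_prod_self_nonneg[of v] scalar_prod_self_eq_0[of v N] by simp
qed

lemma mat_inv_ridge_sym:
  assumes X: "X \<in> carrier_mat N D" and d: "det (ridge e X) \<noteq> 0"
    and uv: "u \<in> carrier_vec N" "v \<in> carrier_vec N"
  shows "u \<bullet> (mat_inv (ridge e X) *\<^sub>v v) = v \<bullet> (mat_inv (ridge e X) *\<^sub>v u)"
proof -
  let ?A = "ridge e X" let ?B = "mat_inv ?A"
  have A: "?A \<in> carrier_mat N N" by (rule ridge_carrier[OF X])
  have c: "?B *\<^sub>v u \<in> carrier_vec N" "?B *\<^sub>v v \<in> carrier_vec N" using mat_inv_carrier[OF A] uv by auto
  have "u \<bullet> (?B *\<^sub>v v) = (?B *\<^sub>v v) \<bullet> (?A *\<^sub>v (?B *\<^sub>v u))"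
    using mat_inv_vec[OF A d] uv c comm_scalar_prod by metis
  also have "\<dots> = (?B *\<^sub>v u) \<bullet> (?A *\<^sub>v (?B *\<^sub>v v))"
    using scalar_prod_ridge[OF X c(1,2)] scalar_prod_ridge[OF X c(2,1)] c X
    by (simp add: comm_scalar_prod[of _ D] comm_scalar_prod[of _ N])
  also have "\<dots> = v \<bullet> (?B *\<^sub>v u)"
    using mat_inv_vec[OF A d] uv c comm_scalar_prod by metis
  finally show ?thesis .
qed

text \<open>With A the ridge matrix, both sides equal z . A z. At e = 0 the right-hand side is |X^+
  v|^2, so the squared error becomes the quadratic form of A^-1 at the noise.\<close>

lemma mat_inv_ridge_quadratic:
  assumes X: "X \<in> carrier_mat N D" and d: "det (ridge e X) \<noteq> 0" and v: "v \<in> carrier_vec N"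
  defines "z \<equiv> mat_inv (ridge e X) *\<^sub>v v"
  shows "v \<bullet> z = (transpose_mat X *\<^sub>v z) \<bullet> (transpose_mat X *\<^sub>v z) + e * (z \<bullet> z)"
proof -
  have z: "z \<in> carrier_vec N" unfolding z_def using X v by (meson mat_inv_carrier mult_mat_vec_carrier ridge_carrier)
  have "v \<bullet> z = z \<bullet> (ridge e X *\<^sub>v z)"
    unfolding z_def using mat_inv_vec(1)[OF ridge_carrier[OF X] d v] z[unfolded z_def] v comm_scalar_prod by metis
  then show ?thesis using scalar_prod_ridge[OF X z z] by simp
qed

lemma mat_inv_ridge_nonneg:
  assumes X: "X \<in> carrier_mat N D" and e: "0 < e" and v: "v \<in> carrier_vec N"
  shows "0 \<le> v \<bullet> (mat_inv (ridge e X) *\<^sub>v v)"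
  using mat_inv_ridge_quadratic[OF X det_ridge_nonzero[OF X e] v] e scalar_prod_self_nonneg by simp

lemma mat_entry_unit_vec:
  assumes "B \<in> carrier_mat n m" "a < n" "b < m"
  shows "B $$ (a, b) = unit_vec n a \<bullet> (B *\<^sub>v unit_vec m (b :: nat) :: real vec)"
proof -
  have "unit_vec n a \<bullet> (B *\<^sub>v unit_vec m b) = (B *\<^sub>v unit_vec m b) $ a"
    using assms by (intro scalar_prod_left_unit[of _ n]) auto
  then show ?thesis using assms by simp
qed

text \<open>The ridge matrix has smallest eigenvalue at least e, so its inverse has norm at most 1 /
  e. This supplies the bounds that integrability and integration by parts ask for.\<close>

lemma mat_inv_ridge_entry_bound:
  assumes X: "X \<in> carrier_mat N D" and e: "0 < e" and ab: "a < N" "b < N"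
  shows "\<bar>mat_inv (ridge e X) $$ (a, b)\<bar> \<le> 1 / e"
proof -
  let ?B = "mat_inv (ridge e X)"
  define z where "z = ?B *\<^sub>v unit_vec N b"
  have B: "?B \<in> carrier_mat N N" by (rule mat_inv_carrier[OF ridge_carrier[OF X]])
  have z: "z \<in> carrier_vec N" using B by (simp add: z_def)
  have za: "z $ i = ?B $$ (i, b)" if "i < N" for i
    using that ab mat_entry_unit_vec[OF B that ab(2)] scalar_prod_left_unit[OF z that]
    by (simp add: z_def)
  have "z $ b = (transpose_mat X *\<^sub>v z) \<bullet> (transpose_mat X *\<^sub>v z) + e * (z \<bullet> z)"
    using mat_inv_ridge_quadratic[OF X det_ridge_nonzero[OF X e] unit_vec_carrier[of N b]] z ab
    by (simp add: z_def)
  then have *: "e * (z \<bullet> z) \<le> z $ b" using scalar_prod_self_nonneg[of "transpose_mat X *\<^sub>v z"] by simp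
  have **: "e * (z $ i)\<^sup>2 \<le> z $ b" if "i < N" for i
    using * scalar_prod_self_ge[of i z] that z e by (smt (verit) carrier_vecD mult_left_mono)
  have "0 \<le> z $ b" using *  e scalar_prod_self_nonneg[of z] by (smt (verit) mult_nonneg_nonneg)
  \<comment> \<open>The inequality e z_b^2 \<le> z_b gives e z_b \<le> 1; together with e z_a^2
    \<le> z_b this yields (e z_a)^2 \<le> e z_b \<le> 1.\<close>
  moreover have "e * (z $ b) * (z $ b) \<le> 1 * (z $ b)" using **[OF ab(2)] by (simp add: power2_eq_square)
  ultimately have "e * z $ b \<le> 1" using mult_right_le_imp_le[of "e * z $ b" "z $ b" 1]
    by (cases "z $ b = 0") auto
  then have "e * (e * (z $ a)\<^sup>2) \<le> 1" using **[OF ab(1)] e by (smt (verit) mult_left_mono)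
  then have "(e * \<bar>z $ a\<bar>)\<^sup>2 \<le> 1" by (simp add: power2_eq_square algebra_simps)
  then have "e * \<bar>z $ a\<bar> \<le> 1" using e by (simp add: abs_square_le_1 abs_mult)
  then show ?thesis using za[OF ab(1)] e by (simp add: field_simps)
qed

lemma mult_mat_vec_minus_smult:
  assumes "A \<in> carrier_mat n m" "u \<in> carrier_vec m" "v \<in> carrier_vec m"
  shows "A *\<^sub>v (u - c \<cdot>\<^sub>v v) = A *\<^sub>v u - c \<cdot>\<^sub>v (A *\<^sub>v (v :: real vec))"
  using assms by (simp add: mult_minus_distrib_mat_vec[of _ n m] mult_mat_vec[of _ n m])

text \<open>Resolvent identity: with A = X X^T and y = (A + e I)^-1 z, the vector (A + e I)^-1 w is
  z - e y. The difference of the two forms is therefore -e (w . y), and w . y lies between 0 and z .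
  z.\<close>

lemma mat_inv_ridge_limit:
  assumes X: "X \<in> carrier_mat N D" and d: "det (ridge 0 X) \<noteq> 0" and e: "0 < e"
    and w: "w \<in> carrier_vec N"
  defines "z \<equiv> mat_inv (ridge 0 X) *\<^sub>v w"
  shows "\<bar>w \<bullet> (mat_inv (ridge e X) *\<^sub>v w) - w \<bullet> z\<bar> \<le> e * (z \<bullet> z)"
proof -
  let ?A = "ridge e X" let ?B = "mat_inv ?A"
  note de = det_ridge_nonzero[OF X e]
  have A: "?A \<in> carrier_mat N N" "ridge 0 X \<in> carrier_mat N N" using X[THEN ridge_carrier] by blast+
  have B: "?B \<in> carrier_mat N N" using A by (intro mat_inv_carrier)
  have z: "z \<in> carrier_vec N" using A w by (metis z_def mat_inv_carrier mult_mat_vec_carrier)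
  have Az: "ridge 0 X *\<^sub>v z = w" using mat_inv_vec(1)[OF A(2) d w] by (simp add: z_def)
  define y where "y = ?B *\<^sub>v z"
  have y: "y \<in> carrier_vec N" using B z by (simp add: y_def)
  have Ay: "?A *\<^sub>v y = z" unfolding y_def using mat_inv_vec(1)[OF A(1) de z] .
  have eq: "ridge 0 X *\<^sub>v y = z - e \<cdot>\<^sub>v y"
    using Ay ridge_mult_vec[OF X y, of e] ridge_0_mult_vec[OF X y] X y z
    by (intro eq_vecI) auto
  have "?A *\<^sub>v z = w + e \<cdot>\<^sub>v z"
    using Az ridge_mult_vec[OF X z, of e] ridge_0_mult_vec[OF X z] by simp
  then have Aw: "?A *\<^sub>v (z - e \<cdot>\<^sub>v y) = w"
    using mult_mat_vec_minus_smult[OF A(1) z y, of e] Ay z w by (intro eq_vecI) auto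
  have Bw: "?B *\<^sub>v w = z - e \<cdot>\<^sub>v y"
    using mat_inv_vec(2)[OF A(1) de, of "z - e \<cdot>\<^sub>v y"] y z by (simp add: Aw)
  have wy: "w \<bullet> y = z \<bullet> z - e * (z \<bullet> y)"
  proof -
    have "w \<bullet> y = y \<bullet> (ridge 0 X *\<^sub>v z)" using Az w y by (simp add: comm_scalar_prod[of _ N])
    also have "\<dots> = z \<bullet> (ridge 0 X *\<^sub>v y)"
      using scalar_prod_ridge[OF X y z, of 0] scalar_prod_ridge[OF X z y, of 0] X y z
      by (simp add: comm_scalar_prod[of _ D])
    also have "\<dots> = z \<bullet> z - e * (z \<bullet> y)" using eq y z by (simp add: scalar_prod_minus_distrib[of _ N])
    finally show ?thesis .
  qed
  have "w \<bullet> (?B *\<^sub>v w) = w \<bullet> z - e * (w \<bullet> y)"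
    using Bw w y z by (simp add: scalar_prod_minus_distrib[of _ N])
  \<comment> \<open>Since w = A z and z = A y + e y, the product w . y equals z . A y = |A y|^2 + e
    |X^T y|^2.\<close>
  moreover have "0 \<le> w \<bullet> y"
  proof -
    have "z - e \<cdot>\<^sub>v y = X *\<^sub>v (transpose_mat X *\<^sub>v y)"
      using eq ridge_0_mult_vec[OF X y] X y by auto
    then have "w \<bullet> y = z \<bullet> (X *\<^sub>v (transpose_mat X *\<^sub>v y))"
      using wy y z scalar_prod_minus_distrib[of z N z "e \<cdot>\<^sub>v y"] by simp
    also have "\<dots> = (X *\<^sub>v (transpose_mat X *\<^sub>v y) + e \<cdot>\<^sub>v y) \<bullet> (X *\<^sub>v (transpose_mat X *\<^sub>v y))"
      using Ay ridge_mult_vec[OF X y, of e] by simp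
    also have "\<dots> = (X *\<^sub>v (transpose_mat X *\<^sub>v y)) \<bullet> (X *\<^sub>v (transpose_mat X *\<^sub>v y)) + 
        e * ((transpose_mat X *\<^sub>v y) \<bullet> (transpose_mat X *\<^sub>v y))"
      using X y by (simp add: add_scalar_prod_distrib[of _ N] transpose_mult_scalar_prod)
    finally show ?thesis using e scalar_prod_self_nonneg by simp
  qed
  moreover have "w \<bullet> y \<le> z \<bullet> z"
    using wy mat_inv_ridge_nonneg[OF X e z] e by (simp add: y_def)
  ultimately show ?thesis using e by (simp add: abs_mult)
qed

text \<open>A kernel vector u of X X^T is an eigenvector of the inverse for the eigenvalue 1 / e,
  and the other eigenvalues are positive. The bound turns control of the expected trace into control
  of the probability that X X^T is singular.\<close>

lemma trace_mat_inv_ridge_singular: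
  assumes X: "X \<in> carrier_mat N D" and d: "det (ridge 0 X) = 0" and e: "0 < e"
  shows "1 / e \<le> (\<Sum>i<N. mat_inv (ridge e X) $$ (i, i))"
proof -
  let ?A = "ridge e X" let ?B = "mat_inv ?A"
  note de = det_ridge_nonzero[OF X e]
  have A: "?A \<in> carrier_mat N N" "ridge 0 X \<in> carrier_mat N N" using X[THEN ridge_carrier] by blast+
  have B: "?B \<in> carrier_mat N N" using A by (intro mat_inv_carrier)
  obtain u where u: "u \<in> carrier_vec N" "u \<noteq> 0\<^sub>v N" "ridge 0 X *\<^sub>v u = 0\<^sub>v N"
    using d det_0_iff_vec_prod_zero ridge_carrier[OF X] by blast
  define s where "s = u \<bullet> u"
  have s: "0 < s" using u scalar_prod_self_nonneg[of u] scalar_prod_self_eq_0[of u N] by (simp add: s_def less_le)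
  have "?A *\<^sub>v u = e \<cdot>\<^sub>v u"
    using u ridge_mult_vec[OF X u(1), of e] ridge_0_mult_vec[OF X u(1)] X by (auto intro!: eq_vecI)
  then have ue: "u = e \<cdot>\<^sub>v (?B *\<^sub>v u)"
    using mat_inv_vec(2)[OF A(1) de u(1)] u B by (simp add: mult_mat_vec[of _ N N])
  have Bu: "?B *\<^sub>v u = (1 / e) \<cdot>\<^sub>v u"
    using e by (subst (2) ue) (simp add: smult_smult_assoc)
  have "(u $ i)\<^sup>2 / (s * e) \<le> ?B $$ (i, i)" if i: "i < N" for i
  proof -
    \<comment> \<open>With this t the vector \<open>?v\<close> is the component of the unit vector
      orthogonal to u. Positivity of the form at \<open>?v\<close> bounds the diagonal entry below
      by the share of u, and these shares add up to 1 / e.\<close>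
    define t where "t = u $ i / s"
    let ?v = "unit_vec N i - t \<cdot>\<^sub>v u"
    have "?B *\<^sub>v ?v = ?B *\<^sub>v unit_vec N i - (t / e) \<cdot>\<^sub>v u"
      using B u Bu by (subst mult_mat_vec_minus_smult[of _ N N]) (auto simp: smult_smult_assoc)
    moreover have c: "?B *\<^sub>v unit_vec N i \<in> carrier_vec N" using B by simp
    moreover have "u \<bullet> (?B *\<^sub>v unit_vec N i) = u $ i / e"
      using mat_inv_ridge_sym[OF X de u(1) unit_vec_carrier[of N i]] Bu u i by simp
    ultimately have "?v \<bullet> (?B *\<^sub>v ?v) = ?B $$ (i, i) - 2 * t * u $ i / e + t\<^sup>2 * s / e"
      using u i e mat_entry_unit_vec[OF B i i]
      by (simp add: scalar_prod_minus_distrib[of _ N] minus_scalar_prod_distrib[of _ N] s_def power2_eq_square field_simps)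
    moreover have "0 \<le> ?v \<bullet> (?B *\<^sub>v ?v)"
      using u by (intro mat_inv_ridge_nonneg[OF X e]) auto
    ultimately have "0 \<le> ?B $$ (i, i) - 2 * t * u $ i / e + t\<^sup>2 * s / e" by linarith
    then show ?thesis using s e by (simp add: t_def power2_eq_square field_simps)
  qed
  then have "(\<Sum>i<N. (u $ i)\<^sup>2 / (s * e)) \<le> (\<Sum>i<N. ?B $$ (i, i))" by (intro sum_mono) auto
  moreover have "(\<Sum>i<N. (u $ i)\<^sup>2 / (s * e)) = 1 / e"
  proof -
    have "(\<Sum>i<N. (u $ i)\<^sup>2) = s" using u by (simp add: s_def scalar_prod_def power2_eq_square atLeast0LessThan)
    then show ?thesis using s by (simp flip: sum_divide_distrib)
  qed
  ultimately show ?thesis by simp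
qed

text \<open>With B the inverse, the sum of the leverages is the trace of X^T B X, which by cyclicity
  is tr (B X X^T) = tr (I - e B).\<close>

lemma sum_col_mat_inv_ridge:
  assumes X: "X \<in> carrier_mat N D" and e: "0 < e"
  shows "(\<Sum>j<D. Matrix.col X j \<bullet> (mat_inv (ridge e X) *\<^sub>v Matrix.col X j))
    = real N - e * (\<Sum>i<N. mat_inv (ridge e X) $$ (i, i))"
proof -
  define B where "B = mat_inv (ridge e X)"
  define Z where "Z = B * X"
  have A: "ridge e X \<in> carrier_mat N N" by (rule ridge_carrier[OF X])
  have B: "B \<in> carrier_mat N N" unfolding B_def by (rule mat_inv_carrier[OF A])
  have Z: "Z \<in> carrier_mat N D" using B X by (simp add: Z_def)
  have "Z * transpose_mat X + e \<cdot>\<^sub>m B = B * ridge e X"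
    using B X by (simp add: Z_def ridge_def mult_add_distrib_mat[of _ N N _ N] mult_smult_distrib[of _ N N _ N] assoc_mult_mat[of _ N N _ D _ N])
  also have "\<dots> = 1\<^sub>m N" unfolding B_def by (rule mat_inv_inverse(2)[OF A det_ridge_nonzero[OF X e]])
  finally have eq: "Z * transpose_mat X + e \<cdot>\<^sub>m B = 1\<^sub>m N" .
  have diag: "(\<Sum>j<D. Z $$ (a, j) * X $$ (a, j)) = 1 - e * B $$ (a, a)" if a: "a < N" for a
  proof -
    have "(\<Sum>j<D. Z $$ (a, j) * X $$ (a, j)) = (Z * transpose_mat X) $$ (a, a)"
      using a Z X by (simp add: scalar_prod_def atLeast0LessThan)
    moreover have "(Z * transpose_mat X + e \<cdot>\<^sub>m B) $$ (a, a) = 1" using eq a by simp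
    ultimately show ?thesis using a B Z X by simp
  qed
  have "Matrix.col X j \<bullet> (B *\<^sub>v Matrix.col X j) = (\<Sum>a<N. Z $$ (a, j) * X $$ (a, j))" if "j < D" for j
  proof -
    have "B *\<^sub>v Matrix.col X j = Matrix.col Z j"
      using that X B by (intro eq_vecI) (simp_all add: Z_def)
    then show ?thesis
      using that X Z by (simp add: scalar_prod_def atLeast0LessThan mult.commute)
  qed
  then have "(\<Sum>j<D. Matrix.col X j \<bullet> (B *\<^sub>v Matrix.col X j)) = (\<Sum>j<D. \<Sum>a<N. Z $$ (a, j) * X $$ (a, j))"
    by simp
  also have "\<dots> = (\<Sum>a<N. \<Sum>j<D. Z $$ (a, j) * X $$ (a, j))" by (rule sum.swap)
  also have "\<dots> = (\<Sum>a<N. 1 - e * B $$ (a, a))" using diag by (intro sum.cong) auto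
  finally show ?thesis by (simp add: sum_subtractf sum_distrib_left B_def)
qed

text \<open>Zeroing row i of X, rather than deleting it, keeps the dimensions; the only price is the extra
diagonal entry 1 / e in the inverse of the ridge matrix.\<close>

definition zero_row :: "nat \<Rightarrow> real mat \<Rightarrow> real mat" where
  "zero_row i X = mat (dim_row X) (dim_col X) (\<lambda>(a, j). if a = i then 0 else X $$ (a, j))"

lemma zero_row_carrier: "X \<in> carrier_mat N D \<Longrightarrow> zero_row i X \<in> carrier_mat N D"
  by (simp add: zero_row_def)

text \<open>Rank-one splitting of X into \<open>zero_row i X\<close> and the matrix that carries
  only row i; the next lemma is its transpose.\<close>

lemma mult_vec_zero_row:
  assumes X: "X \<in> carrier_mat N D" and u: "u \<in> carrier_vec D" and i: "i < N"
  shows "X *\<^sub>v u = zero_row i X *\<^sub>v u + (Matrix.row X i \<bullet> u) \<cdot>\<^sub>v unit_vec N i"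
proof (rule eq_vecI)
  fix a assume "a < dim_vec (zero_row i X *\<^sub>v u + (Matrix.row X i \<bullet> u) \<cdot>\<^sub>v unit_vec N i)"
  then have a: "a < N" by simp
  have "Matrix.row (zero_row i X) a = (if a = i then 0\<^sub>v D else Matrix.row X a)"
    using a X by (auto simp: zero_row_def intro!: eq_vecI)
  then show "(X *\<^sub>v u) $ a = (zero_row i X *\<^sub>v u + (Matrix.row X i \<bullet> u) \<cdot>\<^sub>v unit_vec N i) $ a"
    using a X u i zero_row_carrier[OF X, of i] by auto
qed (use X zero_row_carrier[OF X, of i] in auto)

lemma transpose_mult_vec_zero_row:
  assumes X: "X \<in> carrier_mat N D" and u: "u \<in> carrier_vec N" and i: "i < N"
  shows "transpose_mat X *\<^sub>v u = transpose_mat (zero_row i X) *\<^sub>v u + u $ i \<cdot>\<^sub>v Matrix.row X i"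
proof (rule eq_vecI)
  fix j assume "j < dim_vec (transpose_mat (zero_row i X) *\<^sub>v u + u $ i \<cdot>\<^sub>v Matrix.row X i)"
  then have j: "j < D" using X by simp
  have Z: "zero_row i X \<in> carrier_mat N D" by (rule zero_row_carrier[OF X])
  have "Matrix.col X j = Matrix.col (zero_row i X) j + X $$ (i, j) \<cdot>\<^sub>v unit_vec N i"
    using i j X by (auto simp: zero_row_def intro!: eq_vecI)
  moreover have Zc: "Matrix.col (zero_row i X) j \<in> carrier_vec N" by (rule carrier_vecI) (use Z in simp)
  ultimately have "Matrix.col X j \<bullet> u = Matrix.col (zero_row i X) j \<bullet> u + X $$ (i, j) * u $ i"
    using add_scalar_prod_distrib[of "Matrix.col (zero_row i X) j" N "X $$ (i, j) \<cdot>\<^sub>v unit_vec N i" u] Z u i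
    by (metis Zc scalar_prod_left_unit smult_carrier_vec smult_scalar_prod_distrib unit_vec_carrier)
  then show "(transpose_mat X *\<^sub>v u) $ j = (transpose_mat (zero_row i X) *\<^sub>v u + u $ i \<cdot>\<^sub>v Matrix.row X i) $ j"
    using j X Z i by simp
qed (use X in auto)

section \<open>The residual operator and the Schur complement of a row\<close>

text \<open>This is the residual of the ridge regression of x on the rows of Y. The operator I - Y^T
  (Y Y^T + e I)^-1 Y is a regularized projection onto the orthogonal complement of the row
  space.\<close>

definition resid :: "real \<Rightarrow> real mat \<Rightarrow> real vec \<Rightarrow> real vec" where
  "resid e Y x = x - transpose_mat Y *\<^sub>v (mat_inv (ridge e Y) *\<^sub>v (Y *\<^sub>v x))"

lemma resid_carrier:
  assumes "Y \<in> carrier_mat N D" "x \<in> carrier_vec D"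
  shows "resid e Y x \<in> carrier_vec D"
  by (rule carrier_vecI) (use assms in \<open>simp add: resid_def\<close>)

lemma scalar_prod_resid:
  assumes Y: "Y \<in> carrier_mat N D" and x: "x \<in> carrier_vec D" and u: "u \<in> carrier_vec D"
  shows "u \<bullet> resid e Y x = u \<bullet> x - (Y *\<^sub>v u) \<bullet> (mat_inv (ridge e Y) *\<^sub>v (Y *\<^sub>v x))"
proof -
  have B: "mat_inv (ridge e Y) \<in> carrier_mat N N" by (rule mat_inv_carrier[OF ridge_carrier[OF Y]])
  have c: "mat_inv (ridge e Y) *\<^sub>v (Y *\<^sub>v x) \<in> carrier_vec N"
    "transpose_mat Y *\<^sub>v (mat_inv (ridge e Y) *\<^sub>v (Y *\<^sub>v x)) \<in> carrier_vec D" "Y *\<^sub>v u \<in> carrier_vec N"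
    using B Y x u by auto
  show ?thesis
    unfolding resid_def
    using transpose_mult_scalar_prod[OF Y c(1) u] c u x
    by (simp add: scalar_prod_minus_distrib[of _ D] comm_scalar_prod[of _ D u] comm_scalar_prod[of _ N "Y *\<^sub>v u"])
qed

lemma scalar_prod_resid_sym:
  assumes Y: "Y \<in> carrier_mat N D" and e: "0 < e" and x: "x \<in> carrier_vec D" and u: "u \<in> carrier_vec D"
  shows "u \<bullet> resid e Y x = x \<bullet> resid e Y u"
  using scalar_prod_resid[OF Y x u] scalar_prod_resid[OF Y u x] comm_scalar_prod[OF x u]
    mat_inv_ridge_sym[OF Y det_ridge_nonzero[OF Y e], of "Y *\<^sub>v x" "Y *\<^sub>v u"] x u Y by simp

lemma resid_add_smult:
  assumes Y: "Y \<in> carrier_mat N D" and x: "x \<in> carrier_vec D" and u: "u \<in> carrier_vec D"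
  shows "resid e Y (x + s \<cdot>\<^sub>v u) = resid e Y x + s \<cdot>\<^sub>v resid e Y u"
proof -
  let ?B = "mat_inv (ridge e Y)"
  have B: "?B \<in> carrier_mat N N" by (rule mat_inv_carrier[OF ridge_carrier[OF Y]])
  have "Y *\<^sub>v (x + s \<cdot>\<^sub>v u) = Y *\<^sub>v x + s \<cdot>\<^sub>v (Y *\<^sub>v u)"
    using x u Y by (simp add: mult_add_distrib_mat_vec[of _ N D] mult_mat_vec[of _ N D])
  then have "?B *\<^sub>v (Y *\<^sub>v (x + s \<cdot>\<^sub>v u)) = ?B *\<^sub>v (Y *\<^sub>v x) + s \<cdot>\<^sub>v (?B *\<^sub>v (Y *\<^sub>v u))"
    using x u Y B by (simp add: mult_add_distrib_mat_vec[of _ N N] mult_mat_vec[of _ N N])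
  then have *: "transpose_mat Y *\<^sub>v (?B *\<^sub>v (Y *\<^sub>v (x + s \<cdot>\<^sub>v u)))
      = transpose_mat Y *\<^sub>v (?B *\<^sub>v (Y *\<^sub>v x)) + s \<cdot>\<^sub>v (transpose_mat Y *\<^sub>v (?B *\<^sub>v (Y *\<^sub>v u)))"
    using x u Y B by (simp add: mult_add_distrib_mat_vec[of _ D N] mult_mat_vec[of _ D N])
  have c: "transpose_mat Y *\<^sub>v (?B *\<^sub>v (Y *\<^sub>v x)) \<in> carrier_vec D" "transpose_mat Y *\<^sub>v (?B *\<^sub>v (Y *\<^sub>v u)) \<in> carrier_vec D"
    using B Y x u by auto
  show ?thesis
    unfolding resid_def * using Y c x u by (intro eq_vecI) (simp_all add: algebra_simps)
qed

text \<open>The residual operator S is symmetric with spectrum in [0, 1], so S^2 \<le> S \<le> I.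
  With c the ridge coefficients and t = Y^T c, the two gaps are e (c . c) and t . t + e (c .
  c).\<close>

lemma resid_bounds:
  assumes Y: "Y \<in> carrier_mat N D" and e: "0 < e" and x: "x \<in> carrier_vec D"
  shows "resid e Y x \<bullet> resid e Y x \<le> x \<bullet> resid e Y x" "x \<bullet> resid e Y x \<le> x \<bullet> x"
proof -
  define c where "c = mat_inv (ridge e Y) *\<^sub>v (Y *\<^sub>v x)"
  have B: "mat_inv (ridge e Y) \<in> carrier_mat N N" by (rule mat_inv_carrier[OF ridge_carrier[OF Y]])
  have Yx: "Y *\<^sub>v x \<in> carrier_vec N" using Y x by simp
  have c: "c \<in> carrier_vec N" using B Yx by (simp add: c_def)
  let ?t = "transpose_mat Y *\<^sub>v c"
  have t: "?t \<in> carrier_vec D" using Y c by simp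
  have q: "(Y *\<^sub>v x) \<bullet> c = ?t \<bullet> ?t + e * (c \<bullet> c)"
    using mat_inv_ridge_quadratic[OF Y det_ridge_nonzero[OF Y e] Yx] by (simp add: c_def)
  have tx: "?t \<bullet> x = (Y *\<^sub>v x) \<bullet> c"
    using transpose_mult_scalar_prod[OF Y c x] comm_scalar_prod[OF c Yx] by simp
  have r: "x \<bullet> resid e Y x = x \<bullet> x - (Y *\<^sub>v x) \<bullet> c"
    using scalar_prod_resid[OF Y x x] by (simp add: c_def)
  have "resid e Y x \<bullet> resid e Y x = x \<bullet> x - 2 * (?t \<bullet> x) + ?t \<bullet> ?t"
    unfolding resid_def c_def[symmetric] using x t comm_scalar_prod[OF x t]
    by (simp add: scalar_prod_minus_distrib[of _ D] minus_scalar_prod_distrib[of _ D])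
  then show "resid e Y x \<bullet> resid e Y x \<le> x \<bullet> resid e Y x"
    using r q tx e scalar_prod_self_nonneg[of c] by simp
  show "x \<bullet> resid e Y x \<le> x \<bullet> x"
    using r q e mult_nonneg_nonneg[of e "c \<bullet> c"] scalar_prod_self_nonneg[of c] scalar_prod_self_nonneg[of ?t]
    by linarith
qed

text \<open>This is the Schur complement formula: the denominator depends on row i only through x.\<close>

lemma mat_inv_ridge_diag:
  assumes X: "X \<in> carrier_mat N D" and e: "0 < e" and i: "i < N"
  defines "x \<equiv> Matrix.row X i"
  shows "mat_inv (ridge e X) $$ (i, i) = 1 / (e + x \<bullet> resid e (zero_row i X) x)"
proof -
  let ?A = "ridge e X" let ?B = "mat_inv ?A"
  define Y where "Y = zero_row i X"
  define C where "C = mat_inv (ridge e Y)"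
  have Y: "Y \<in> carrier_mat N D" unfolding Y_def using X by (rule zero_row_carrier)
  have x: "x \<in> carrier_vec D" using X i by (auto simp: x_def intro: carrier_vecI)
  have A: "?A \<in> carrier_mat N N" "ridge e Y \<in> carrier_mat N N" by (rule ridge_carrier[OF X], rule ridge_carrier[OF Y])
  have B: "?B \<in> carrier_mat N N" using A by (intro mat_inv_carrier)
  have C: "C \<in> carrier_mat N N" unfolding C_def by (rule mat_inv_carrier[OF A(2)])
  have Yx: "Y *\<^sub>v x \<in> carrier_vec N" using Y x by simp
  define c where "c = C *\<^sub>v (Y *\<^sub>v x)"
  have c: "c \<in> carrier_vec N" using C Yx by (simp add: c_def)
  have Yc: "transpose_mat Y *\<^sub>v c \<in> carrier_vec D" using Y c by simp
  have rowi: "(Y *\<^sub>v u) $ i = 0" if "u \<in> carrier_vec D" for u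
  proof -
    have "Matrix.row Y i = 0\<^sub>v D" using X i by (auto simp: Y_def zero_row_def intro!: eq_vecI)
    then show ?thesis using that Y i by simp
  qed
  have YYc: "Y *\<^sub>v (transpose_mat Y *\<^sub>v c) + e \<cdot>\<^sub>v c = Y *\<^sub>v x"
    using mat_inv_vec(1)[OF A(2) det_ridge_nonzero[OF Y e] Yx] ridge_mult_vec[OF Y c, of e] by (simp add: c_def C_def)
  have "(Y *\<^sub>v (transpose_mat Y *\<^sub>v c)) $ i + e * c $ i = (Y *\<^sub>v x) $ i"
    using arg_cong[OF YYc, of "\<lambda>v. v $ i"] c Y i by simp
  \<comment> \<open>Row i of Y vanishes, so coordinate i of the normal equation reads e c_i =
    0.\<close>
  then have ci: "c $ i = 0" using rowi[OF x] rowi[OF Yc] e by simp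
  \<comment> \<open>Up to scale, v is column i of the inverse: the ridge matrix of X maps it to a
    multiple of the unit vector. As v_i = 1, that multiple is the reciprocal of the diagonal
    entry.\<close>
  define v where "v = unit_vec N i - c"
  have v: "v \<in> carrier_vec N" using c by (simp add: v_def)
  have vi: "v $ i = 1" using i c ci by (simp add: v_def)
  have "transpose_mat Y *\<^sub>v unit_vec N i = 0\<^sub>v D"
    using X i by (intro eq_vecI) (auto simp: Y_def zero_row_def)
  then have "transpose_mat Y *\<^sub>v v = - (transpose_mat Y *\<^sub>v c)"
    using c Y Yc unfolding v_def by (simp add: mult_minus_distrib_mat_vec[of _ D N])
  then have XTv: "transpose_mat X *\<^sub>v v = resid e Y x"
    using transpose_mult_vec_zero_row[OF X v i] vi Y Yc x
    unfolding resid_def c_def[symmetric] C_def[symmetric] Y_def[symmetric] x_def[symmetric]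
    by (intro eq_vecI) auto
  have "X *\<^sub>v resid e Y x = Y *\<^sub>v x - Y *\<^sub>v (transpose_mat Y *\<^sub>v c) + (x \<bullet> resid e Y x) \<cdot>\<^sub>v unit_vec N i"
    using mult_vec_zero_row[OF X resid_carrier[OF Y x, of e] i] Y Yc x
    unfolding Y_def[symmetric] x_def[symmetric] 
    by (simp add: resid_def C_def[symmetric] c_def[symmetric] mult_minus_distrib_mat_vec[of _ N D])
  then have "?A *\<^sub>v v = (Y *\<^sub>v x - Y *\<^sub>v (transpose_mat Y *\<^sub>v c) + (x \<bullet> resid e Y x) \<cdot>\<^sub>v unit_vec N i) + e \<cdot>\<^sub>v v"
    using ridge_mult_vec[OF X v, of e] XTv by simp
  also have "\<dots> = (e + x \<bullet> resid e Y x) \<cdot>\<^sub>v unit_vec N i"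
    unfolding v_def YYc[symmetric] using c Y Yc
    by (intro eq_vecI) (auto simp: algebra_simps)
  finally have Av: "?A *\<^sub>v v = (e + x \<bullet> resid e Y x) \<cdot>\<^sub>v unit_vec N i" .
  have "v = (e + x \<bullet> resid e Y x) \<cdot>\<^sub>v (?B *\<^sub>v unit_vec N i)"
    using mat_inv_vec(2)[OF A(1) det_ridge_nonzero[OF X e] v] B by (simp add: Av mult_mat_vec[of _ N N])
  then have "v $ i = (e + x \<bullet> resid e Y x) * ?B $$ (i, i)"
    using B i by (metis (no_types, lifting) carrier_matD(1) dim_mult_mat_vec index_smult_vec(1) mat_entry_unit_vec mult_mat_vec_carrier scalar_prod_left_unit unit_vec_carrier)
  then have "1 = (e + x \<bullet> resid e Y x) * ?B $$ (i, i)" using vi by simp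
  then show ?thesis unfolding Y_def
    by (metis mult_eq_0_iff nonzero_mult_div_cancel_left zero_neq_one)
qed

text \<open>The sum is the trace of the residual operator, D - N + e tr C with C the inverse ridge
  matrix of the zeroed matrix. The zero row contributes e C_ii = 1, so the bound counts only the N -
  1 remaining rows.\<close>

lemma sum_resid_zero_row:
  assumes X: "X \<in> carrier_mat N D" and e: "0 < e" and i: "i < N"
  shows "real D - real N + 1 \<le> (\<Sum>j<D. unit_vec D j \<bullet> resid e (zero_row i X) (unit_vec D j))"
proof -
  define Y where "Y = zero_row i X"
  let ?C = "mat_inv (ridge e Y)"
  have Y: "Y \<in> carrier_mat N D" unfolding Y_def using X by (rule zero_row_carrier)
  have A: "ridge e Y \<in> carrier_mat N N" by (rule ridge_carrier[OF Y])
  have C: "?C \<in> carrier_mat N N" using A by (intro mat_inv_carrier)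
  have Ycol: "Y *\<^sub>v unit_vec D j = Matrix.col Y j" if "j < D" for j
    using that Y by (intro eq_vecI) auto
  have "(\<Sum>j<D. unit_vec D j \<bullet> resid e Y (unit_vec D j)) = (\<Sum>j<D. 1 - Matrix.col Y j \<bullet> (?C *\<^sub>v Matrix.col Y j))"
    using scalar_prod_resid[OF Y unit_vec_carrier unit_vec_carrier] Ycol by (intro sum.cong) auto
  also have "\<dots> = real D - real N + e * (\<Sum>i<N. ?C $$ (i, i))"
    using sum_col_mat_inv_ridge[OF Y e] by (simp add: sum_subtractf)
  also have "\<dots> \<ge> real D - real N + 1"
  proof -
    have "transpose_mat Y *\<^sub>v unit_vec N i = 0\<^sub>v D"
      using X i by (intro eq_vecI) (auto simp: Y_def zero_row_def)
    then have "ridge e Y *\<^sub>v unit_vec N i = e \<cdot>\<^sub>v unit_vec N i"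
      using ridge_mult_vec[OF Y unit_vec_carrier, of e i] Y by (auto intro!: eq_vecI)
    then have "unit_vec N i = e \<cdot>\<^sub>v (?C *\<^sub>v unit_vec N i)"
      using mat_inv_vec(2)[OF A det_ridge_nonzero[OF Y e] unit_vec_carrier, of i] C by (simp add: mult_mat_vec[of _ N N])
    then have "unit_vec N i $ i = e * ?C $$ (i, i)"
      using C i by (metis (no_types, lifting) carrier_matD(1) dim_mult_mat_vec index_smult_vec(1) mat_entry_unit_vec mult_mat_vec_carrier scalar_prod_left_unit unit_vec_carrier)
    then have "1 = e * ?C $$ (i, i)" using i by simp
    moreover have "?C $$ (i, i) \<le> (\<Sum>i<N. ?C $$ (i, i))"
      using i mat_inv_ridge_nonneg[OF Y e unit_vec_carrier] mat_entry_unit_vec[OF C]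
      by (intro member_le_sum) auto
    ultimately show ?thesis using e by (smt (verit) mult_left_mono)
  qed
  finally show ?thesis by (simp add: Y_def)
qed

section \<open>Appending the noise as a column\<close>

text \<open>Sherman-Morrison: the new column adds w w^T to the Gram matrix, so if z solves the old
  ridge system with right-hand side w, the new ridge matrix maps z to (1 + q) w.\<close>

lemma scalar_prod_mat_inv_ridge_Suc:
  fixes g :: "nat \<times> nat \<Rightarrow> real" and N D
  assumes e: "0 < e"
  defines "w \<equiv> Matrix.vec N (\<lambda>a. g (a, D))"
  defines "q \<equiv> w \<bullet> (mat_inv (ridge e (mat N D g)) *\<^sub>v w)"
  shows "w \<bullet> (mat_inv (ridge e (mat N (Suc D) g)) *\<^sub>v w) = q / (1 + q)"
proof -
  let ?X = "mat N D g" let ?G = "mat N (Suc D) g"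
  have X: "?X \<in> carrier_mat N D" "?G \<in> carrier_mat N (Suc D)" by auto
  have A: "ridge e ?X \<in> carrier_mat N N" "ridge e ?G \<in> carrier_mat N N" using X[THEN ridge_carrier] by blast+
  have B: "mat_inv (ridge e ?X) \<in> carrier_mat N N" "mat_inv (ridge e ?G) \<in> carrier_mat N N" using A[THEN mat_inv_carrier] by blast+
  have w: "w \<in> carrier_vec N" by (simp add: w_def)
  define z where "z = mat_inv (ridge e ?X) *\<^sub>v w"
  have z: "z \<in> carrier_vec N" using B w by (simp add: z_def)
  have q: "q = w \<bullet> z" by (simp add: q_def z_def)
  have "ridge e ?G *\<^sub>v z = ridge e ?X *\<^sub>v z + q \<cdot>\<^sub>v w"
    unfolding ridge_mult_vec[OF X(1) z] ridge_mult_vec[OF X(2) z]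
    using z by (intro eq_vecI) (auto simp: q w_def scalar_prod_def)
  also have "\<dots> = (1 + q) \<cdot>\<^sub>v w"
    using mat_inv_vec(1)[OF A(1) det_ridge_nonzero[OF X(1) e] w] w
    by (simp add: z_def add_smult_distrib_vec)
  finally have "ridge e ?G *\<^sub>v z = (1 + q) \<cdot>\<^sub>v w" .
  then have "z = (1 + q) \<cdot>\<^sub>v (mat_inv (ridge e ?G) *\<^sub>v w)"
    using mat_inv_vec(2)[OF A(2) det_ridge_nonzero[OF X(2) e] z] w B by (simp add: mult_mat_vec[of _ N N])
  then have "w \<bullet> z = (1 + q) * (w \<bullet> (mat_inv (ridge e ?G) *\<^sub>v w))"
    using w B(2) by (metis mult_mat_vec_carrier scalar_prod_smult_distrib)
  moreover have "0 \<le> q" using mat_inv_ridge_nonneg[OF X(1) e w] by (simp add: q_def)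
  ultimately show ?thesis by (simp add: q_def z_def field_simps)
qed

section \<open>Integration by parts for Gaussian product measures\<close>

definition std_normal :: "real measure" where
  "std_normal = density lborel std_normal_density"

lemma sets_std_normal [simp, measurable_cong]: "sets std_normal = sets borel"
  by (simp add: std_normal_def)

lemma space_std_normal [simp]: "space std_normal = UNIV"
  by (simp add: std_normal_def)

interpretation std_normal: prob_space std_normal
  unfolding std_normal_def by (rule prob_space_normal_density) simp

interpretation gauss: product_prob_space "\<lambda>_. std_normal" J for J
  by unfold_locales

lemma integrable_std_normal_bounded_growth:
  fixes f :: "real \<Rightarrow> real"
  assumes f[measurable]: "f \<in> borel_measurable borel" and b: "\<And>t. \<bar>f t\<bar> \<le> a + b * \<bar>t\<bar> ^ n"
  shows "integrable std_normal f"
proof -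
  have "integrable lborel (\<lambda>t. a * (std_normal_density t * \<bar>t\<bar> ^ 0) + b * (std_normal_density t * \<bar>t\<bar> ^ n))"
    by (intro Bochner_Integration.integrable_add integrable_mult_right integrable_std_normal_moment_abs)
  then have "integrable lborel (\<lambda>t. std_normal_density t * f t)"
  proof (rule Bochner_Integration.integrable_bound)
    show "AE t in lborel. norm (std_normal_density t * f t)
        \<le> norm (a * (std_normal_density t * \<bar>t\<bar> ^ 0) + b * (std_normal_density t * \<bar>t\<bar> ^ n))"
    proof (intro AE_I2)
      fix t
      have "norm (std_normal_density t * f t) \<le> std_normal_density t * (a + b * \<bar>t\<bar> ^ n)"
        using b[of t] by (simp add: abs_mult mult_left_mono)
      then show "norm (std_normal_density t * f t) \<le> norm (a * (std_normal_density t * \<bar>t\<bar> ^ 0) + b * (std_normal_density t * \<bar>t\<bar> ^ n))"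
        by (simp add: algebra_simps)
    qed
  qed simp
  then show ?thesis by (simp add: std_normal_def integrable_density)
qed

text \<open>Stein's identity: with p the normal density, p (f' - t f) is the derivative of p f, so
  its integral is a difference of limits of p f at infinity. The bound on f' gives f at most linear
  growth, which makes these limits 0 and all integrands integrable.\<close>

lemma std_normal_stein:
  fixes f f' :: "real \<Rightarrow> real"
  assumes deriv: "\<And>t. (f has_real_derivative f' t) (at t)"
    and cont: "\<And>t. isCont f' t" and bound: "\<And>t. \<bar>f' t\<bar> \<le> C"
  shows "(\<integral>t. t * f t \<partial>std_normal) = (\<integral>t. f' t \<partial>std_normal)"
proof -
  let ?p = std_normal_density
  have contf: "continuous_on UNIV f" using deriv DERIV_isCont continuous_at_imp_continuous_on by blast
  have [measurable]: "f \<in> borel_measurable borel" using borel_measurable_continuous_onI[OF contf] .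
  have [measurable]: "f' \<in> borel_measurable borel"
    using cont continuous_at_imp_continuous_on by (intro borel_measurable_continuous_onI) blast
  have fb: "\<bar>f t\<bar> \<le> \<bar>f 0\<bar> + C * \<bar>t\<bar>" for t
  proof -
    have "norm (f t - f 0) \<le> C * norm (t - 0)"
      using bound by (intro field_differentiable_bound[of UNIV f f']) (auto intro: deriv)
    then show ?thesis by simp
  qed
  have C: "0 \<le> C" using bound[of 0] by linarith
  have i1: "integrable std_normal f'"
    using bound by (intro integrable_std_normal_bounded_growth[of _ C 0 0]) auto
  have i2: "integrable std_normal (\<lambda>t. t * f t)"
  proof (rule integrable_std_normal_bounded_growth[of _ "\<bar>f 0\<bar>" "\<bar>f 0\<bar> + C" 2])
    fix t
    have "\<bar>t * f t\<bar> \<le> \<bar>t\<bar> * (\<bar>f 0\<bar> + C * \<bar>t\<bar>)" using fb[of t] by (simp add: abs_mult mult_left_mono)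
    also have "\<dots> = \<bar>f 0\<bar> * \<bar>t\<bar> + C * t\<^sup>2" by (simp add: algebra_simps power2_eq_square)
    also have "\<dots> \<le> \<bar>f 0\<bar> * (1 + t\<^sup>2) + C * t\<^sup>2"
    proof -
      have "0 \<le> (\<bar>t\<bar> - 1)\<^sup>2 + t\<^sup>2 + 1" by simp
      then have "\<bar>t\<bar> \<le> 1 + t\<^sup>2" by (simp add: power2_eq_square algebra_simps)
      then show ?thesis by (simp add: mult_left_mono)
    qed
    finally show "\<bar>t * f t\<bar> \<le> \<bar>f 0\<bar> + (\<bar>f 0\<bar> + C) * \<bar>t\<bar>\<^sup>2" by (simp add: algebra_simps)
  qed measurable
  have dp: "(?p has_real_derivative - t * ?p t) (at t)" for t
    unfolding std_normal_density_def by (auto intro!: derivative_eq_intros simp: field_simps)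
  have pc: "isCont ?p t" for t using dp DERIV_isCont by blast
  have fc: "isCont f t" for t using deriv DERIV_isCont by blast
  have lim0: "((\<lambda>t. ?p t * f t) \<longlongrightarrow> 0) F" 
    if F: "((\<lambda>t. ?p t * (\<bar>f 0\<bar> + C * \<bar>t\<bar>)) \<longlongrightarrow> 0) F" for F :: "real filter"
  proof (rule Lim_null_comparison[OF _ F], intro always_eventually allI)
    show "norm (?p t * f t) \<le> ?p t * (\<bar>f 0\<bar> + C * \<bar>t\<bar>)" for t
      using fb[of t] by (simp add: abs_mult mult_left_mono)
  qed
  have "((\<lambda>t. ?p t * f t) \<longlongrightarrow> 0) at_top"
    by (intro lim0) (unfold std_normal_density_def, real_asymp)
  then have top: "(((\<lambda>t. ?p t * f t) \<circ> real_of_ereal) \<longlongrightarrow> 0) (at_left \<infinity>)"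
    by (simp add: ereal_tendsto_simps1)
  have "((\<lambda>t. ?p t * f t) \<longlongrightarrow> 0) at_bot"
    by (intro lim0) (unfold std_normal_density_def, real_asymp)
  then have bot: "(((\<lambda>t. ?p t * f t) \<circ> real_of_ereal) \<longlongrightarrow> 0) (at_right (-\<infinity>))"
    by (simp add: ereal_tendsto_simps1)
  have int: "integrable std_normal (\<lambda>t. f' t - t * f t)" using i1 i2 by simp
  then have int': "integrable lborel (\<lambda>t. ?p t * (f' t - t * f t))"
    by (simp add: std_normal_def integrable_density)
  have "(LBINT t=-\<infinity>..\<infinity>. ?p t * (f' t - t * f t)) = 0 - 0"
  proof (rule interval_integral_FTC_integrable[OF _ _ _ _ bot top])
    show "((\<lambda>t. ?p t * f t) has_vector_derivative ?p t * (f' t - t * f t)) (at t)" for t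
      using DERIV_mult[OF dp deriv] by (simp add: has_real_derivative_iff_has_vector_derivative algebra_simps)
    show "isCont (\<lambda>t. ?p t * (f' t - t * f t)) t" for t
      using pc fc cont by (intro continuous_intros)
  qed (use int' in \<open>auto simp: set_integrable_def\<close>)
  then have "(LBINT t. ?p t * (f' t - t * f t)) = 0"
    by (simp add: interval_lebesgue_integral_def set_lebesgue_integral_def)
  then have "(\<integral>t. f' t - t * f t \<partial>std_normal) = 0"
    by (simp add: std_normal_def integral_density)
  then show ?thesis using i1 i2 by simp
qed

abbreviation gauss :: "'i set \<Rightarrow> ('i \<Rightarrow> real) measure" where
  "gauss J \<equiv> Pi\<^sub>M J (\<lambda>_. std_normal)"

lemma prob_space_gauss: "prob_space (gauss J)"
  by (rule prob_space_PiM) (rule std_normal.prob_space_axioms)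

lemma integrable_gauss_bounded:
  fixes f :: "('i \<Rightarrow> real) \<Rightarrow> real"
  assumes "f \<in> borel_measurable (gauss J)" "\<And>g. \<bar>f g\<bar> \<le> C"
  shows "integrable (gauss J) f"
  using assms prob_space.finite_measure[OF prob_space_gauss]
  by (intro finite_measure.integrable_const_bound[of _ _ C]) auto

text \<open>Fubini reduces this to the one-dimensional identity in coordinate k. Derivative and
  continuity are required only at the point \<open>g k\<close>, but for every g; applying them to
  \<open>g(k := t)\<close> yields them at every t.\<close>

lemma gauss_stein:
  fixes F F' :: "('i \<Rightarrow> real) \<Rightarrow> real"
  assumes J: "finite J" "k \<in> J"
    and [measurable]: "F' \<in> borel_measurable (gauss J)"
    and int: "integrable (gauss J) (\<lambda>g. g k * F g)"
    and deriv: "\<And>g. ((\<lambda>t. F (g(k := t))) has_real_derivative F' g) (at (g k))"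
    and cont: "\<And>g. isCont (\<lambda>t. F' (g(k := t))) (g k)"
    and bound: "\<And>g. \<bar>F' g\<bar> \<le> C"
  shows "(\<integral>g. g k * F g \<partial>gauss J) = (\<integral>g. F' g \<partial>gauss J)"
proof -
  define I where "I = J - {k}"
  have JI: "J = insert k I" and I: "finite I" "k \<notin> I" using J by (auto simp: I_def)
  have int': "integrable (gauss J) F'" using bound by (intro integrable_gauss_bounded[of _ _ C]) auto
  have stein: "(\<integral>t. t * F (g(k := t)) \<partial>std_normal) = (\<integral>t. F' (g(k := t)) \<partial>std_normal)" for g
  proof (rule std_normal_stein)
    fix t
    show "((\<lambda>t. F (g(k := t))) has_real_derivative F' (g(k := t))) (at t)"
      using deriv[of "g(k := t)"] by simp
    show "isCont (\<lambda>t. F' (g(k := t))) t" using cont[of "g(k := t)"] by simp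
    show "\<bar>F' (g(k := t))\<bar> \<le> C" by (rule bound)
  qed
  show ?thesis
    using gauss.product_integral_insert[OF I int[unfolded JI]]
      gauss.product_integral_insert[OF I int'[unfolded JI]] stein
    by (simp add: JI)
qed

lemma distr_gauss_component: "k \<in> J \<Longrightarrow> distr (gauss J) borel (\<lambda>g. g k) = std_normal"
  using gauss.PiM_component[of k J] distr_cong[of "gauss J" "gauss J" borel std_normal "\<lambda>g. g k" "\<lambda>g. g k"]
  by simp

lemma integrable_gauss_square:
  assumes k: "k \<in> J"
  shows "integrable (gauss J) (\<lambda>g. (g k)\<^sup>2)"
proof -
  have "integrable std_normal (\<lambda>t. t\<^sup>2)"
    by (rule integrable_std_normal_bounded_growth[of _ 0 1 2]) auto
  then have "integrable (distr (gauss J) borel (\<lambda>g. g k)) (\<lambda>t. t\<^sup>2)"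
    using distr_gauss_component[OF k] by simp
  then show ?thesis using k by (subst (asm) integrable_distr_eq) auto
qed

text \<open>Exchangeability of iid coordinates; it is applied to the swap of two columns of
  [X | w].\<close>

lemma integral_gauss_reindex:
  fixes h :: "('i \<Rightarrow> real) \<Rightarrow> real"
  assumes p: "inj_on p J" "p \<in> J \<rightarrow> J" and h[measurable]: "h \<in> borel_measurable (gauss J)"
  shows "(\<integral>g. h (\<lambda>k\<in>J. g (p k)) \<partial>gauss J) = (\<integral>g. h g \<partial>gauss J)"
proof -
  have "distr (gauss J) (gauss J) (\<lambda>g. \<lambda>k\<in>J. g (p k)) = gauss J"
    using distr_PiM_reindex[of J "\<lambda>_. std_normal" p J] p std_normal.prob_space_axioms by simp
  moreover have "(\<lambda>g. \<lambda>k\<in>J. g (p k)) \<in> gauss J \<rightarrow>\<^sub>M gauss J"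
    using p by (intro measurable_restrict measurable_component_singleton) auto
  ultimately show ?thesis using integral_distr[of "\<lambda>g. \<lambda>k\<in>J. g (p k)" "gauss J" "gauss J" h] h by simp
qed

section \<open>Measurability of matrix expressions\<close>

text \<open>Dimensions are values here, so measurability is expressed entry by entry. The dimension
  is prescribed at every point, also outside the space of P, which allows entries to be rewritten as
  equal functions.\<close>

definition mat_measurable :: "'b measure \<Rightarrow> nat \<Rightarrow> nat \<Rightarrow> ('b \<Rightarrow> real mat) \<Rightarrow> bool" where
  "mat_measurable P n m A \<longleftrightarrow>
    (\<forall>g. A g \<in> carrier_mat n m) \<and> (\<forall>a<n. \<forall>b<m. (\<lambda>g. A g $$ (a, b)) \<in> borel_measurable P)"

definition vec_measurable :: "'b measure \<Rightarrow> nat \<Rightarrow> ('b \<Rightarrow> real vec) \<Rightarrow> bool" where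
  "vec_measurable P n v \<longleftrightarrow>
    (\<forall>g. v g \<in> carrier_vec n) \<and> (\<forall>a<n. (\<lambda>g. v g $ a) \<in> borel_measurable P)"

lemma mat_measurable_carrier: "mat_measurable P n m A \<Longrightarrow> A g \<in> carrier_mat n m"
  unfolding mat_measurable_def by blast

lemma vec_measurable_carrier: "vec_measurable P n v \<Longrightarrow> v g \<in> carrier_vec n"
  unfolding vec_measurable_def by blast

lemma mat_measurable_entry:
  "mat_measurable P n m A \<Longrightarrow> a < n \<Longrightarrow> b < m \<Longrightarrow> (\<lambda>g. A g $$ (a, b)) \<in> borel_measurable P"
  by (simp add: mat_measurable_def)

lemma vec_measurable_entry:
  "vec_measurable P n v \<Longrightarrow> a < n \<Longrightarrow> (\<lambda>g. v g $ a) \<in> borel_measurable P"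
  by (simp add: vec_measurable_def)

lemma mat_measurable_transpose:
  "mat_measurable P n m A \<Longrightarrow> mat_measurable P m n (\<lambda>g. transpose_mat (A g))"
  unfolding mat_measurable_def
proof (intro conjI allI impI)
  fix a b assume A: "(\<forall>g. A g \<in> carrier_mat n m) \<and> (\<forall>a<n. \<forall>b<m. (\<lambda>g. A g $$ (a, b)) \<in> borel_measurable P)"
    and ab: "a < m" "b < n"
  have "(\<lambda>g. transpose_mat (A g) $$ (a, b)) = (\<lambda>g. A g $$ (b, a))"
    using A ab by (metis carrier_matD index_transpose_mat(1))
  then show "(\<lambda>g. transpose_mat (A g) $$ (a, b)) \<in> borel_measurable P" using A ab by simp
qed (simp add: transpose_carrier_mat)

lemma scalar_prod_measurable:
  assumes "vec_measurable P n u" "vec_measurable P n v"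
  shows "(\<lambda>g. u g \<bullet> v g) \<in> borel_measurable P"
proof -
  have "dim_vec (v g) = n" for g using vec_measurable_carrier[OF assms(2)] by simp
  then have "(\<lambda>g. u g \<bullet> v g) = (\<lambda>g. \<Sum>a\<in>{0..<n}. u g $ a * v g $ a)"
    by (simp add: scalar_prod_def)
  moreover have "(\<lambda>g. \<Sum>a\<in>{0..<n}. u g $ a * v g $ a) \<in> borel_measurable P"
    using assms by (intro borel_measurable_sum borel_measurable_times vec_measurable_entry) auto
  ultimately show ?thesis by simp
qed

lemma mult_mat_vec_measurable:
  assumes A: "mat_measurable P n m A" and v: "vec_measurable P m v"
  shows "vec_measurable P n (\<lambda>g. A g *\<^sub>v v g)"
proof -
  have c: "A g \<in> carrier_mat n m" "v g \<in> carrier_vec m" for g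
    using assms by (auto intro: mat_measurable_carrier vec_measurable_carrier)
  have "(\<lambda>g. (A g *\<^sub>v v g) $ a) \<in> borel_measurable P" if a: "a < n" for a
  proof -
    have "vec_measurable P m (\<lambda>g. Matrix.row (A g) a)"
      unfolding vec_measurable_def
    proof (intro conjI allI impI)
      show "Matrix.row (A g) a \<in> carrier_vec m" for g by (rule carrier_vecI) (use carrier_matD(2)[OF c(1)] in simp)
      fix b assume b: "b < m"
      have "(\<lambda>g. Matrix.row (A g) a $ b) = (\<lambda>g. A g $$ (a, b))"
        using a b carrier_matD[OF c(1)] by simp
      then show "(\<lambda>g. Matrix.row (A g) a $ b) \<in> borel_measurable P"
        using mat_measurable_entry[OF A a b] by simp
    qed
    then have "(\<lambda>g. Matrix.row (A g) a \<bullet> v g) \<in> borel_measurable P" by (rule scalar_prod_measurable[OF _ v])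
    moreover have "(\<lambda>g. (A g *\<^sub>v v g) $ a) = (\<lambda>g. Matrix.row (A g) a \<bullet> v g)"
      using a carrier_matD[OF c(1)] by simp
    ultimately show ?thesis by simp
  qed
  then show ?thesis using mult_mat_vec_carrier[OF c] unfolding vec_measurable_def by blast
qed

lemma det_measurable:
  assumes A: "mat_measurable P n n A"
  shows "(\<lambda>g. det (A g)) \<in> borel_measurable P"
proof -
  have c: "A g \<in> carrier_mat n n" for g using A by (rule mat_measurable_carrier)
  have "(\<lambda>g. \<Sum>p | p permutes {0..<n}. signof p * (\<Prod>i = 0..<n. A g $$ (i, p i))) \<in> borel_measurable P"
    by (intro borel_measurable_sum borel_measurable_times borel_measurable_const borel_measurable_prod
        mat_measurable_entry[OF A]) (use permutes_in_image in fastforce)+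
  then show ?thesis using det_def'[OF c] by simp
qed

text \<open>By Cramer's rule the entries are quotients of polynomials in the entries of the matrix.
  With 1 / 0 = 0 the formula covers singular matrices as well, so no null set has to be
  removed.\<close>

lemma mat_inv_measurable:
  assumes A: "mat_measurable P n n A"
  shows "mat_measurable P n n (\<lambda>g. mat_inv (A g))"
proof -
  have c: "A g \<in> carrier_mat n n" for g using A by (rule mat_measurable_carrier)
  have dims: "dim_row (A g) = n" "dim_col (A g) = n" for g using c[of g] by auto
  have "(\<lambda>g. mat_inv (A g) $$ (a, b)) \<in> borel_measurable P" if ab: "a < n" "b < n" for a b
  proof -
    have "mat_measurable P (n - 1) (n - 1) (\<lambda>g. mat_delete (A g) b a)"
      unfolding mat_measurable_def
    proof (intro conjI allI impI)
      show "mat_delete (A g) b a \<in> carrier_mat (n - 1) (n - 1)" for g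
        by (rule mat_delete_carrier[OF c])
      fix i j assume ij: "i < n - 1" "j < n - 1"
      have "(\<lambda>g. mat_delete (A g) b a $$ (i, j)) =
          (\<lambda>g. A g $$ (if i < b then i else Suc i, if j < a then j else Suc j))"
        using ij by (simp add: mat_delete_def dims)
      then show "(\<lambda>g. mat_delete (A g) b a $$ (i, j)) \<in> borel_measurable P"
        using mat_measurable_entry[OF A] ij by simp
    qed
    then have [measurable]: "(\<lambda>g. det (mat_delete (A g) b a)) \<in> borel_measurable P" by (rule det_measurable)
    have [measurable]: "(\<lambda>g. det (A g)) \<in> borel_measurable P" by (rule det_measurable[OF A])
    have "(\<lambda>g. mat_inv (A g) $$ (a, b)) = (\<lambda>g. 1 / det (A g) * ((- 1) ^ (b + a) * det (mat_delete (A g) b a)))"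
      using ab by (simp add: mat_inv_eq_adj_mat[OF c] adj_mat_def cofactor_def dims)
    then show ?thesis by simp
  qed
  then show ?thesis using mat_inv_carrier[OF c] unfolding mat_measurable_def by blast
qed

lemma ridge_measurable:
  assumes A: "mat_measurable P n m A"
  shows "mat_measurable P n n (\<lambda>g. ridge e (A g))"
proof -
  have c: "A g \<in> carrier_mat n m" for g using A by (rule mat_measurable_carrier)
  have dims: "dim_row (A g) = n" "dim_col (A g) = m" for g using c[of g] by auto
  have "(\<lambda>g. ridge e (A g) $$ (a, b)) \<in> borel_measurable P" if ab: "a < n" "b < n" for a b
  proof -
    have "(\<lambda>g. ridge e (A g) $$ (a, b)) = (\<lambda>g. (\<Sum>j\<in>{0..<m}. A g $$ (a, j) * A g $$ (b, j)) + e * (if a = b then 1 else 0))"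
      using ab by (simp add: ridge_def dims scalar_prod_def)
    moreover have "\<dots> \<in> borel_measurable P"
      using ab by (intro borel_measurable_add borel_measurable_sum borel_measurable_times borel_measurable_const
          mat_measurable_entry[OF A]) auto
    ultimately show ?thesis by simp
  qed
  then show ?thesis using ridge_carrier[OF c] unfolding mat_measurable_def by blast
qed

lemma mat_measurable_gauss:
  assumes "{..<N} \<times> {..<D} \<subseteq> J"
  shows "mat_measurable (gauss J) N D (mat N D)"
  unfolding mat_measurable_def
proof (intro conjI allI impI)
  fix a b assume ab: "a < N" "b < D"
  then have "(a, b) \<in> J" using assms by auto
  then have "(\<lambda>g. g (a, b)) \<in> borel_measurable (gauss J)" by measurable
  then show "(\<lambda>g. mat N D g $$ (a, b)) \<in> borel_measurable (gauss J)" using ab by simp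
qed auto

lemma vec_measurable_gauss:
  assumes "\<And>a. a < n \<Longrightarrow> k a \<in> J"
  shows "vec_measurable (gauss J) n (\<lambda>g. Matrix.vec n (\<lambda>a. g (k a)))"
  unfolding vec_measurable_def
proof (intro conjI allI impI)
  fix a assume a: "a < n"
  then have "k a \<in> J" using assms by auto
  then have "(\<lambda>g. g (k a)) \<in> borel_measurable (gauss J)" by measurable
  then show "(\<lambda>g. Matrix.vec n (\<lambda>a. g (k a)) $ a) \<in> borel_measurable (gauss J)" using a by simp
qed auto

lemma zero_row_measurable:
  assumes A: "mat_measurable P n m A"
  shows "mat_measurable P n m (\<lambda>g. zero_row i (A g))"
proof -
  have c: "A g \<in> carrier_mat n m" for g using A by (rule mat_measurable_carrier)
  have dims: "dim_row (A g) = n" "dim_col (A g) = m" for g using c[of g] by auto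
  have "(\<lambda>g. zero_row i (A g) $$ (a, b)) \<in> borel_measurable P" if "a < n" "b < m" for a b
    using that mat_measurable_entry[OF A that] by (cases "a = i") (simp_all add: zero_row_def dims)
  then show ?thesis using zero_row_carrier[OF c] unfolding mat_measurable_def by blast
qed

lemma resid_measurable:
  assumes Y: "mat_measurable P n m Y" and x: "vec_measurable P m x"
  shows "vec_measurable P m (\<lambda>g. resid e (Y g) (x g))"
proof -
  have c: "Y g \<in> carrier_mat n m" "x g \<in> carrier_vec m" for g
    using assms by (auto intro: mat_measurable_carrier vec_measurable_carrier)
  let ?t = "\<lambda>g. transpose_mat (Y g) *\<^sub>v (mat_inv (ridge e (Y g)) *\<^sub>v (Y g *\<^sub>v x g))"
  have t: "vec_measurable P m ?t"
    by (rule mult_mat_vec_measurable[OF mat_measurable_transpose[OF Y]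
          mult_mat_vec_measurable[OF mat_inv_measurable[OF ridge_measurable[OF Y]] mult_mat_vec_measurable[OF Y x]]])
  have dt: "dim_vec (?t g) = m" for g by (rule carrier_vecD[OF vec_measurable_carrier[OF t]])
  have "(\<lambda>g. resid e (Y g) (x g) $ a) \<in> borel_measurable P" if a: "a < m" for a
  proof -
    have "(\<lambda>g. resid e (Y g) (x g) $ a) = (\<lambda>g. x g $ a - ?t g $ a)"
      using a dt unfolding resid_def by simp
    then show ?thesis using vec_measurable_entry[OF x a] vec_measurable_entry[OF t a] by simp
  qed
  then show ?thesis using resid_carrier[OF c] unfolding vec_measurable_def by blast
qed

section \<open>Expectations under the Gaussian measure\<close>

lemma zero_row_update:
  "zero_row i (mat N D (g((i, j) := t))) = zero_row i (mat N D g)"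
  by (rule eq_matI) (auto simp: zero_row_def)

lemma vec_row_update:
  fixes g :: "nat \<times> nat \<Rightarrow> real"
  assumes "j < D"
  shows "Matrix.vec D (\<lambda>l. (g((i, j) := t)) (i, l))
    = Matrix.vec D (\<lambda>l. g (i, l)) + (t - g (i, j)) \<cdot>\<^sub>v unit_vec D j"
  using assms by (intro eq_vecI) (auto simp: index_unit_vec)

text \<open>Given the other rows, the entry is 1 / (e + r) with r a quadratic form in the Gaussian
  row x whose operator is close to a projection of rank D - N + 1. Heuristically r is chi-square
  with D - N + 1 degrees of freedom, and the inverse of such a variable has mean 1 / (D - N - 1).
  Integration by parts gives this value as an upper bound for every e. The index set J may exceed
  the matrix, because the bound is applied to X and to [X | w] on the same space.\<close>

lemma integral_mat_inv_diag_le: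
  assumes J: "finite J" "{..<N} \<times> {..<D} \<subseteq> J" and e: "0 < e" and i: "i < N" and ND: "N + 1 < D"
  shows "(\<integral>g. mat_inv (ridge e (mat N D g)) $$ (i, i) \<partial>gauss J) \<le> 1 / (real D - real N - 1)"
proof -
  define Y where "Y g = zero_row i (mat N D g)" for g :: "nat \<times> nat \<Rightarrow> real"
  define x where "x g = Matrix.vec D (\<lambda>j. g (i, j))" for g :: "nat \<times> nat \<Rightarrow> real"
  define R where "R g = resid e (Y g) (x g)" for g
  define r where "r g = x g \<bullet> R g" for g
  define Q where "Q g j = unit_vec D j \<bullet> resid e (Y g) (unit_vec D j)" for g j
  have Y: "Y g \<in> carrier_mat N D" for g unfolding Y_def by (rule zero_row_carrier) simp
  have x: "x g \<in> carrier_vec D" for g by (simp add: x_def)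
  have R: "R g \<in> carrier_vec D" for g unfolding R_def by (rule resid_carrier[OF Y x])
  have RR: "R g \<bullet> R g \<le> r g" for g unfolding r_def R_def by (rule resid_bounds[OF Y e x])
  have r0: "0 \<le> r g" for g using RR[of g] scalar_prod_self_nonneg[of "R g"] by linarith
  have er: "0 < e + r g" for g using r0[of g] e by linarith
  have Rj: "(R g $ j)\<^sup>2 \<le> r g" if "j < D" for g j
    using scalar_prod_self_ge[of j "R g"] that R[of g] RR[of g] by simp
  have Q01: "0 \<le> Q g j" "Q g j \<le> 1" if "j < D" for g j
  proof -
    note b = resid_bounds[OF Y[of g] e unit_vec_carrier[of D j]]
    show "0 \<le> Q g j" unfolding Q_def
      using b(1) scalar_prod_self_nonneg[of "resid e (Y g) (unit_vec D j)"] by linarith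
    show "Q g j \<le> 1" unfolding Q_def using b(2) that by simp
  qed
  have diag: "mat_inv (ridge e (mat N D g)) $$ (i, i) = 1 / (e + r g)" for g
  proof -
    have "Matrix.row (mat N D g) i = x g" using i by (intro eq_vecI) (auto simp: x_def)
    then show ?thesis using mat_inv_ridge_diag[of "mat N D g" N D e i] e i by (simp add: r_def R_def Y_def)
  qed
  \<comment> \<open>Component j of the vector field R / (e + r) in the row x, and its partial
    derivative in the entry (i, j): R is linear in x with diagonal coefficient Q, and r has gradient
    2 R.\<close>
  define F where "F j g = R g $ j / (e + r g)" for j g
  define F' where "F' j g = Q g j / (e + r g) - 2 * (R g $ j)\<^sup>2 / (e + r g)\<^sup>2" for j g
  \<comment> \<open>Changing one entry of row i leaves Y unchanged. Hence R_j is affine and r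
    quadratic in that entry, and no inverse matrix has to be differentiated.\<close>
  have Y_upd: "Y (g((i, j) := t)) = Y g" for g j t by (simp add: Y_def zero_row_update)
  have Q_upd: "Q (g((i, j) := t)) j' = Q g j'" for g j t j' by (simp add: Q_def Y_upd)
  have R_upd: "R (g((i, j) := t)) = R g + (t - g (i, j)) \<cdot>\<^sub>v resid e (Y g) (unit_vec D j)" if j: "j < D" for g j t
    unfolding R_def Y_upd
    unfolding x_def vec_row_update[OF j] using resid_add_smult[OF Y x unit_vec_carrier] by (simp add: x_def)
  have Rj_upd: "R (g((i, j) := t)) $ j = R g $ j + (t - g (i, j)) * Q g j" if j: "j < D" for g j t
  proof -
    have c: "resid e (Y g) (unit_vec D j) \<in> carrier_vec D" by (rule resid_carrier[OF Y unit_vec_carrier])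
    then show ?thesis using R_upd[OF j] j R[of g] by (simp add: Q_def)
  qed
  have r_upd: "r (g((i, j) := t)) = r g + 2 * (t - g (i, j)) * R g $ j + (t - g (i, j))\<^sup>2 * Q g j" if j: "j < D" for g j t
  proof -
    let ?s = "t - g (i, j)" let ?u = "unit_vec D j" let ?Ru = "resid e (Y g) (unit_vec D j)"
    have c: "?Ru \<in> carrier_vec D" by (rule resid_carrier[OF Y unit_vec_carrier])
    have xu: "x (g((i, j) := t)) = x g + ?s \<cdot>\<^sub>v ?u" unfolding x_def by (rule vec_row_update[OF j])
    \<comment> \<open>Symmetry of the residual operator makes both cross terms equal to R_j; this is
      the origin of the factor 2 in the gradient of r.\<close>
    have s: "x g \<bullet> ?Ru = R g $ j"
      using scalar_prod_resid_sym[OF Y[of g] e unit_vec_carrier[of D j] x[of g]] j R[of g] by (simp add: R_def)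
    have u1: "?u \<bullet> R g = R g $ j" using R[of g] j by simp
    have "r (g((i, j) := t)) = (x g + ?s \<cdot>\<^sub>v ?u) \<bullet> (R g + ?s \<cdot>\<^sub>v ?Ru)"
      unfolding r_def R_upd[OF j] xu ..
    also have "\<dots> = x g \<bullet> R g + ?s * (x g \<bullet> ?Ru) + ?s * (?u \<bullet> R g + ?s * (?u \<bullet> ?Ru))"
      using c x[of g] R[of g]
      by (subst add_scalar_prod_distrib[of _ D]) (auto simp: scalar_prod_add_distrib[of _ D] algebra_simps)
    finally show ?thesis using s u1 by (simp add: r_def Q_def power2_eq_square algebra_simps)
  qed
  have mx: "vec_measurable (gauss J) D x"
    unfolding x_def using J i by (intro vec_measurable_gauss) auto
  have mY: "mat_measurable (gauss J) N D Y"
    unfolding Y_def by (rule zero_row_measurable[OF mat_measurable_gauss[OF J(2)]])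
  have mR: "vec_measurable (gauss J) D R"
    unfolding R_def by (rule resid_measurable[OF mY mx])
  have mr[measurable]: "r \<in> borel_measurable (gauss J)"
    unfolding r_def by (rule scalar_prod_measurable[OF mx mR])
  have mRj: "(\<lambda>g. R g $ j) \<in> borel_measurable (gauss J)" if "j < D" for j
    by (rule vec_measurable_entry[OF mR that])
  have mu: "vec_measurable (gauss J) D (\<lambda>_. unit_vec D j)" for j
    by (simp add: vec_measurable_def)
  have mQ: "(\<lambda>g. Q g j) \<in> borel_measurable (gauss J)" for j
    unfolding Q_def by (rule scalar_prod_measurable[OF mu resid_measurable[OF mY mu]])
  have intF: "integrable (gauss J) (\<lambda>g. g (i, j) * F j g)" if j: "j < D" for j
  proof -
    have kJ: "(i, j) \<in> J" using J i j by auto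
    have [measurable]: "(\<lambda>g. g (i, j)) \<in> borel_measurable (gauss J)" using kJ by measurable
    note [measurable] = mRj[OF j]
    have "integrable (gauss J) (\<lambda>g. (1 / e + 1) * (1 + (g (i, j))\<^sup>2))"
      using integrable_gauss_square[OF kJ] integrable_gauss_bounded[of "\<lambda>_. 1" J 1]
      by (intro integrable_mult_right Bochner_Integration.integrable_add) auto
    then show ?thesis
    proof (rule Bochner_Integration.integrable_bound)
      show "AE g in gauss J. norm (g (i, j) * F j g) \<le> norm ((1 / e + 1) * (1 + (g (i, j))\<^sup>2))"
      proof (intro AE_I2)
        fix g :: "nat \<times> nat \<Rightarrow> real"
        have "2 * \<bar>R g $ j\<bar> \<le> 1 + (R g $ j)\<^sup>2"
          using zero_le_power2[of "\<bar>R g $ j\<bar> - 1"] by (simp add: power2_diff)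
        then have "\<bar>R g $ j\<bar> \<le> 1 + r g" using Rj[OF j, of g] by linarith
        also have "\<dots> \<le> (1 / e + 1) * (e + r g)"
          using e r0[of g] by (simp add: field_simps)
        finally have Fb: "\<bar>F j g\<bar> \<le> 1 / e + 1"
          using er[of g] by (simp add: F_def abs_divide abs_of_pos divide_le_eq)
        have "2 * \<bar>g (i, j)\<bar> \<le> 1 + (g (i, j))\<^sup>2"
          using zero_le_power2[of "\<bar>g (i, j)\<bar> - 1"] by (simp add: power2_diff)
        then have gb: "\<bar>g (i, j)\<bar> \<le> 1 + (g (i, j))\<^sup>2" by linarith
        have "\<bar>g (i, j)\<bar> * \<bar>F j g\<bar> \<le> (1 + (g (i, j))\<^sup>2) * (1 / e + 1)"
          using gb Fb by (intro mult_mono) auto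
        then show "norm (g (i, j) * F j g) \<le> norm ((1 / e + 1) * (1 + (g (i, j))\<^sup>2))"
          using e by (simp add: abs_mult mult.commute)
      qed
    qed (simp add: F_def)
  qed
  have mF': "F' j \<in> borel_measurable (gauss J)" if j: "j < D" for j
  proof -
    note [measurable] = mRj[OF j] mQ[of j]
    show ?thesis unfolding F'_def by measurable
  qed
  \<comment> \<open>The summand 1 / e comes from Q \<le> 1, and 2 / e from R_j^2 \<le> r.\<close>
  have F'b: "\<bar>F' j g\<bar> \<le> 3 / e" if j: "j < D" for j g
  proof -
    have "\<bar>Q g j / (e + r g)\<bar> \<le> 1 / e"
      using Q01[OF j, of g] er[of g] e r0[of g] by (simp add: frac_le)
    moreover have "\<bar>2 * (R g $ j)\<^sup>2 / (e + r g)\<^sup>2\<bar> \<le> 2 / e"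
    proof -
      have "(R g $ j)\<^sup>2 * e \<le> (e + r g) * (e + r g)"
        using Rj[OF j, of g] e r0[of g] by (intro mult_mono) auto
      then have "2 * (R g $ j)\<^sup>2 / (e + r g)\<^sup>2 \<le> 2 / e"
        using e er[of g] by (simp add: power2_eq_square[of "e + r g"] divide_simps)
      moreover have "0 \<le> 2 * (R g $ j)\<^sup>2 / (e + r g)\<^sup>2" by simp
      ultimately show ?thesis by (simp only: abs_of_nonneg)
    qed
    ultimately have "\<bar>F' j g\<bar> \<le> 1 / e + 2 / e"
      unfolding F'_def by (rule order_trans[OF abs_triangle_ineq4 add_mono])
    then show ?thesis by simp
  qed
  have stein: "(\<integral>g. g (i, j) * F j g \<partial>gauss J) = (\<integral>g. F' j g \<partial>gauss J)" if j: "j < D" for j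
  proof (rule gauss_stein[OF J(1) _ mF'[OF j] intF[OF j] _ _ F'b[OF j]])
    show "(i, j) \<in> J" using J i j by auto
    fix g
    have nz: "e + r g \<noteq> 0" using er[of g] by simp
    show "((\<lambda>t. F j (g((i, j) := t))) has_real_derivative F' j g) (at (g (i, j)))"
    proof -
      have d1: "((\<lambda>t. R g $ j + (t - g (i, j)) * Q g j) has_real_derivative Q g j) (at (g (i, j)))"
        by (auto intro!: derivative_eq_intros)
      have d2: "((\<lambda>t. e + (r g + 2 * (t - g (i, j)) * R g $ j + (t - g (i, j))\<^sup>2 * Q g j))
          has_real_derivative 2 * R g $ j) (at (g (i, j)))"
        by (auto intro!: derivative_eq_intros)
      have "((\<lambda>t. (R g $ j + (t - g (i, j)) * Q g j) /
            (e + (r g + 2 * (t - g (i, j)) * R g $ j + (t - g (i, j))\<^sup>2 * Q g j)))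
          has_real_derivative (Q g j * (e + r g) - R g $ j * (2 * R g $ j)) / ((e + r g) * (e + r g))) (at (g (i, j)))"
        using DERIV_divide[OF d1 d2] nz by simp
      moreover have "(Q g j * (e + r g) - R g $ j * (2 * R g $ j)) / ((e + r g) * (e + r g)) = F' j g"
        using nz by (simp add: F'_def diff_divide_distrib power2_eq_square)
      ultimately show ?thesis unfolding F_def Rj_upd[OF j] r_upd[OF j] by simp
    qed
    show "isCont (\<lambda>t. F' j (g((i, j) := t))) (g (i, j))"
      unfolding F'_def Rj_upd[OF j] r_upd[OF j] Q_upd using nz
      by (intro continuous_intros) auto
  qed
  have int_inv: "integrable (gauss J) (\<lambda>g. 1 / (e + r g))"
  proof (rule integrable_gauss_bounded[of _ _ "1 / e"])
    show "\<bar>1 / (e + r g)\<bar> \<le> 1 / e" for g using e r0[of g] by (simp add: frac_le)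
  qed measurable
  \<comment> \<open>The divergence of the field R / (e + r) in the row x dominates (D - N - 1) / (e + r), while its
    scalar product with x is r / (e + r), hence at most 1.\<close>
  have "(real D - real N - 1) * (\<integral>g. 1 / (e + r g) \<partial>gauss J) = (\<integral>g. (real D - real N - 1) * (1 / (e + r g)) \<partial>gauss J)"
    using int_inv by (intro integral_mult_right_zero[symmetric])
  also have "\<dots> \<le> (\<integral>g. (\<Sum>j<D. F' j g) \<partial>gauss J)"
  proof (rule integral_mono)
    show "integrable (gauss J) (\<lambda>g. (real D - real N - 1) * (1 / (e + r g)))"
      by (intro integrable_mult_right int_inv)
    show "integrable (gauss J) (\<lambda>g. \<Sum>j<D. F' j g)"
      using mF' F'b by (intro Bochner_Integration.integrable_sum integrable_gauss_bounded) auto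
    fix g
    have "(\<Sum>j<D. Q g j) \<ge> real D - real N + 1"
      unfolding Q_def Y_def by (rule sum_resid_zero_row[OF _ e i]) simp
    then have 1: "(\<Sum>j<D. Q g j) / (e + r g) \<ge> (real D - real N + 1) / (e + r g)"
      using er[of g] by (intro divide_right_mono) auto
    \<comment> \<open>Because |R|^2 \<le> r, differentiating the denominator costs at most 2 / (e +
      r), which lowers D - N + 1 to D - N - 1.\<close>
    have "(\<Sum>j<D. (R g $ j)\<^sup>2) = R g \<bullet> R g"
      using R[of g] by (simp add: scalar_prod_def power2_eq_square atLeast0LessThan)
    then have "2 * (\<Sum>j<D. (R g $ j)\<^sup>2) / (e + r g)\<^sup>2 \<le> 2 * (e + r g) / (e + r g)\<^sup>2"
      using RR[of g] e by (intro divide_right_mono) auto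
    also have "\<dots> = 2 / (e + r g)" using er[of g] by (simp add: power2_eq_square del: distrib_left_numeral)
    finally have 2: "2 * (\<Sum>j<D. (R g $ j)\<^sup>2) / (e + r g)\<^sup>2 \<le> 2 / (e + r g)" .
    have "(\<Sum>j<D. F' j g) = (\<Sum>j<D. Q g j) / (e + r g) - 2 * (\<Sum>j<D. (R g $ j)\<^sup>2) / (e + r g)\<^sup>2"
      by (simp add: F'_def sum_subtractf sum_divide_distrib sum_distrib_left)
    moreover have "(real D - real N - 1) * (1 / (e + r g)) = (real D - real N + 1) / (e + r g) - 2 / (e + r g)"
      by (simp add: diff_divide_distrib add_divide_distrib)
    ultimately show "(real D - real N - 1) * (1 / (e + r g)) \<le> (\<Sum>j<D. F' j g)" using 1 2 by linarith
  qed
  also have "\<dots> = (\<Sum>j<D. \<integral>g. F' j g \<partial>gauss J)"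
    using mF' F'b by (intro Bochner_Integration.integral_sum integrable_gauss_bounded) auto
  also have "\<dots> = (\<Sum>j<D. \<integral>g. g (i, j) * F j g \<partial>gauss J)" using stein by simp
  also have "\<dots> = (\<integral>g. (\<Sum>j<D. g (i, j) * F j g) \<partial>gauss J)"
    using intF by (intro Bochner_Integration.integral_sum[symmetric]) auto
  also have "\<dots> \<le> (\<integral>g. 1 \<partial>gauss J)"
  proof (rule integral_mono)
    show "integrable (gauss J) (\<lambda>g. \<Sum>j<D. g (i, j) * F j g)"
      using intF by (intro Bochner_Integration.integrable_sum) auto
    show "integrable (gauss J) (\<lambda>_. 1 :: real)" by (rule integrable_gauss_bounded[of _ _ 1]) auto
    fix g
    have "(\<Sum>j<D. g (i, j) * F j g) = r g / (e + r g)"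
      using R[of g] by (simp add: F_def r_def x_def scalar_prod_def atLeast0LessThan sum_divide_distrib)
    also have "\<dots> \<le> 1" using e er[of g] by (simp add: divide_le_eq)
    finally show "(\<Sum>j<D. g (i, j) * F j g) \<le> 1" .
  qed
  also have "\<dots> = 1" using prob_space.prob_space[OF prob_space_gauss[of J]] by simp
  finally show ?thesis using ND by (simp add: diag field_simps)
qed

section \<open>The regularized squared error and its two moments\<close>

text \<open>This is w . (X X^T + e I)^-1 w, the regularized V^2. Design and noise are read off one
  function g, with w in column D, so that a single product measure carries both and columns can be
  exchanged.\<close>

definition ridge_form :: "real \<Rightarrow> nat \<Rightarrow> nat \<Rightarrow> (nat \<times> nat \<Rightarrow> real) \<Rightarrow> real" where
  "ridge_form e N D g = Matrix.vec N (\<lambda>a. g (a, D))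
     \<bullet> (mat_inv (ridge e (mat N D g)) *\<^sub>v Matrix.vec N (\<lambda>a. g (a, D)))"

lemma ridge_form_measurable:
  assumes "{..<N} \<times> {..<Suc D} \<subseteq> J"
  shows "ridge_form e N D \<in> borel_measurable (gauss J)"
proof -
  have s: "{..<N} \<times> {..<D} \<subseteq> J" using assms by auto
  have w: "vec_measurable (gauss J) N (\<lambda>g. Matrix.vec N (\<lambda>a. g (a, D)))"
    using assms by (intro vec_measurable_gauss) auto
  have "(\<lambda>g. ridge_form e N D g) \<in> borel_measurable (gauss J)"
    unfolding ridge_form_def
    by (rule scalar_prod_measurable[OF w mult_mat_vec_measurable[OF
            mat_inv_measurable[OF ridge_measurable[OF mat_measurable_gauss[OF s]]] w]])
  then show ?thesis by simp
qed

lemma ridge_form_nonneg: "0 < e \<Longrightarrow> 0 \<le> ridge_form e N D g"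
  unfolding ridge_form_def by (rule mat_inv_ridge_nonneg[OF mat_carrier]) auto

text \<open>With B the inverse ridge matrix of X, the mean of w . B w is that of tr B, because B
  does not involve w. Integration by parts in the noise entries shows this, with (B w)_a as the
  function differentiated; then each diagonal entry is bounded.\<close>

lemma integral_ridge_form_le:
  assumes e: "0 < e" and ND: "N + 1 < D"
  defines "J \<equiv> {..<N} \<times> {..<Suc D}"
  shows "integrable (gauss J) (ridge_form e N D)"
    and "(\<integral>g. ridge_form e N D g \<partial>gauss J) \<le> real N / (real D - real N - 1)"
proof -
  define B where "B g = mat_inv (ridge e (mat N D g))" for g :: "nat \<times> nat \<Rightarrow> real"
  define w where "w g = Matrix.vec N (\<lambda>a. g (a, D))" for g :: "nat \<times> nat \<Rightarrow> real"
  have J: "finite J" "{..<N} \<times> {..<D} \<subseteq> J" by (auto simp: J_def)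
  have kJ: "(a, D) \<in> J" if "a < N" for a using that by (auto simp: J_def)
  have B: "B g \<in> carrier_mat N N" for g
    unfolding B_def by (rule mat_inv_carrier[OF ridge_carrier[OF mat_carrier]])
  have w: "w g \<in> carrier_vec N" for g by (simp add: w_def)
  have Bb: "\<bar>B g $$ (a, b)\<bar> \<le> 1 / e" if "a < N" "b < N" for a b g
    unfolding B_def by (rule mat_inv_ridge_entry_bound[OF mat_carrier e that])
  have mB: "mat_measurable (gauss J) N N B"
    unfolding B_def by (rule mat_inv_measurable[OF ridge_measurable[OF mat_measurable_gauss[OF J(2)]]])
  define F where "F a g = (B g *\<^sub>v w g) $ a" for a g
  have F_sum: "F a g = (\<Sum>b<N. B g $$ (a, b) * g (b, D))" if a: "a < N" for a g
  proof -
    have "F a g = Matrix.row (B g) a \<bullet> w g" using a B[of g] by (simp add: F_def)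
    also have "\<dots> = (\<Sum>b<N. B g $$ (a, b) * g (b, D))"
      using a B[of g] by (auto simp: scalar_prod_def w_def atLeast0LessThan intro!: sum.cong)
    finally show ?thesis .
  qed
  have wv: "w g \<bullet> v = (\<Sum>a<N. g (a, D) * v $ a)" if "dim_vec v = N" for g v
    using that by (simp add: scalar_prod_def w_def atLeast0LessThan)
  have q: "ridge_form e N D g = (\<Sum>a<N. g (a, D) * F a g)" for g
    unfolding ridge_form_def B_def[symmetric] w_def[symmetric] F_def
    using B[of g] by (intro wv) simp
  have intF: "integrable (gauss J) (\<lambda>g. g (a, D) * F a g)" if a: "a < N" for a
  proof -
    have "integrable (gauss J) (\<lambda>g. \<Sum>b<N. g (a, D) * (B g $$ (a, b) * g (b, D)))"
    proof (intro Bochner_Integration.integrable_sum)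
      fix b assume "b \<in> {..<N}"
      then have b: "b < N" by simp
      note [measurable] = mat_measurable_entry[OF mB a b]
      have [measurable]: "(\<lambda>g. g (a, D)) \<in> borel_measurable (gauss J)" "(\<lambda>g. g (b, D)) \<in> borel_measurable (gauss J)"
        using kJ[OF a] kJ[OF b] by measurable
      have "integrable (gauss J) (\<lambda>g. 1 / e * ((g (a, D))\<^sup>2 + (g (b, D))\<^sup>2))"
        using integrable_gauss_square[OF kJ[OF a]] integrable_gauss_square[OF kJ[OF b]]
        by (intro integrable_mult_right Bochner_Integration.integrable_add) auto
      then show "integrable (gauss J) (\<lambda>g. g (a, D) * (B g $$ (a, b) * g (b, D)))"
      proof (rule Bochner_Integration.integrable_bound)
        show "AE g in gauss J. norm (g (a, D) * (B g $$ (a, b) * g (b, D))) \<le> norm (1 / e * ((g (a, D))\<^sup>2 + (g (b, D))\<^sup>2))"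
        proof (intro AE_I2)
          fix g :: "nat \<times> nat \<Rightarrow> real"
          have "2 * (\<bar>g (a, D)\<bar> * \<bar>g (b, D)\<bar>) \<le> (g (a, D))\<^sup>2 + (g (b, D))\<^sup>2"
            using zero_le_power2[of "\<bar>g (a, D)\<bar> - \<bar>g (b, D)\<bar>"] by (simp add: power2_diff)
          moreover have "0 \<le> \<bar>g (a, D)\<bar> * \<bar>g (b, D)\<bar>" by simp
          ultimately have "\<bar>g (a, D)\<bar> * \<bar>g (b, D)\<bar> \<le> (g (a, D))\<^sup>2 + (g (b, D))\<^sup>2" by linarith
          then have "\<bar>B g $$ (a, b)\<bar> * (\<bar>g (a, D)\<bar> * \<bar>g (b, D)\<bar>) \<le> 1 / e * ((g (a, D))\<^sup>2 + (g (b, D))\<^sup>2)"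
            using Bb[OF a b, of g] e by (intro mult_mono) auto
          then show "norm (g (a, D) * (B g $$ (a, b) * g (b, D))) \<le> norm (1 / e * ((g (a, D))\<^sup>2 + (g (b, D))\<^sup>2))"
            using e by (simp add: abs_mult ac_simps)
        qed
      qed measurable
    qed
    then show ?thesis using F_sum[OF a] by (simp add: sum_distrib_left)
  qed
  \<comment> \<open>B reads only the columns before D, so (B w)_a is affine in the noise entry w_a
    with slope B_aa.\<close>
  have B_upd: "B (g((a, D) := t)) = B g" for g a t
  proof -
    have "mat N D (g((a, D) := t)) = mat N D g" by (rule eq_matI) auto
    then show ?thesis by (simp add: B_def)
  qed
  have F_upd: "F a (g((a, D) := t)) = F a g + (t - g (a, D)) * B g $$ (a, a)" if a: "a < N" for a g t
  proof -
    have "F a (g((a, D) := t)) - F a g = (\<Sum>b<N. B g $$ (a, b) * ((g((a, D) := t)) (b, D) - g (b, D)))"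
      unfolding F_sum[OF a] B_upd by (simp add: sum_subtractf right_diff_distrib)
    also have "\<dots> = (\<Sum>b<N. if b = a then B g $$ (a, b) * (t - g (a, D)) else 0)"
      by (intro sum.cong) auto
    also have "\<dots> = B g $$ (a, a) * (t - g (a, D))" using a by (simp add: sum.delta)
    finally show ?thesis by (simp add: algebra_simps)
  qed
  have stein: "(\<integral>g. g (a, D) * F a g \<partial>gauss J) = (\<integral>g. B g $$ (a, a) \<partial>gauss J)" if a: "a < N" for a
  proof (rule gauss_stein[OF J(1) kJ[OF a] mat_measurable_entry[OF mB a a] intF[OF a] _ _ Bb[OF a a]])
    fix g
    show "((\<lambda>t. F a (g((a, D) := t))) has_real_derivative B g $$ (a, a)) (at (g (a, D)))"
      unfolding F_upd[OF a] by (auto intro!: derivative_eq_intros)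
    show "isCont (\<lambda>t. B (g((a, D) := t)) $$ (a, a)) (g (a, D))"
      unfolding B_upd by simp
  qed
  have "integrable (gauss J) (\<lambda>g. ridge_form e N D g)"
    unfolding q using intF by (intro Bochner_Integration.integrable_sum) auto
  then show "integrable (gauss J) (ridge_form e N D)" by simp
  have "(\<integral>g. ridge_form e N D g \<partial>gauss J) = (\<Sum>a<N. \<integral>g. g (a, D) * F a g \<partial>gauss J)"
    unfolding q using intF by (intro Bochner_Integration.integral_sum) auto
  also have "\<dots> \<le> (\<Sum>a<N. 1 / (real D - real N - 1))"
  proof (intro sum_mono)
    fix a assume "a \<in> {..<N}"
    then have a: "a < N" by simp
    show "(\<integral>g. g (a, D) * F a g \<partial>gauss J) \<le> 1 / (real D - real N - 1)"
      unfolding stein[OF a] B_def by (rule integral_mat_inv_diag_le[OF J e a ND])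
  qed
  finally show "(\<integral>g. ridge_form e N D g \<partial>gauss J) \<le> real N / (real D - real N - 1)" by simp
qed

text \<open>By \<open>scalar_prod_mat_inv_ridge_Suc\<close> the integrand is the leverage of the
  last column of [X | w]. Regularization lowers the total leverage from N to N - e tr T, with T the
  inverse ridge matrix of [X | w]; bounding the mean of tr T makes the loss of order e.\<close>

lemma integral_ridge_form_ratio_ge:
  assumes e: "0 < e" and ND: "N < D"
  defines "J \<equiv> {..<N} \<times> {..<Suc D}"
  shows "(real N - e * (real N / (real D - real N))) / (real D + 1)
    \<le> (\<integral>g. ridge_form e N D g / (1 + ridge_form e N D g) \<partial>gauss J)"
proof -
  define T where "T g = mat_inv (ridge e (mat N (Suc D) g))" for g :: "nat \<times> nat \<Rightarrow> real"
  define col where "col j g = Matrix.vec N (\<lambda>a. g (a, j))" for j and g :: "nat \<times> nat \<Rightarrow> real"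
  define h where "h j g = col j g \<bullet> (T g *\<^sub>v col j g)" for j g
  define tr where "tr g = (\<Sum>i<N. T g $$ (i, i))" for g
  have J: "finite J" "{..<N} \<times> {..<Suc D} \<subseteq> J" by (auto simp: J_def)
  have hD: "h D g = ridge_form e N D g / (1 + ridge_form e N D g)" for g
    unfolding h_def T_def col_def ridge_form_def by (rule scalar_prod_mat_inv_ridge_Suc[OF e])
  have h01: "\<bar>h D g\<bar> \<le> 1" for g
    using ridge_form_nonneg[OF e, of N D g] by (simp add: hD abs_divide abs_of_nonneg divide_le_eq)
  have mT: "mat_measurable (gauss J) N N T"
    unfolding T_def by (rule mat_inv_measurable[OF ridge_measurable[OF mat_measurable_gauss[OF J(2)]]])
  have mh: "h j \<in> borel_measurable (gauss J)" if "j < Suc D" for j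
  proof -
    have c: "vec_measurable (gauss J) N (col j)"
      unfolding col_def using that by (intro vec_measurable_gauss) (auto simp: J_def)
    have "(\<lambda>g. h j g) \<in> borel_measurable (gauss J)"
      unfolding h_def by (rule scalar_prod_measurable[OF c mult_mat_vec_measurable[OF mT c]])
    then show ?thesis by simp
  qed
  \<comment> \<open>Swapping columns j and D of [X | w] only reorders the sums in the Gram matrix,
    so T is unchanged while column j moves to position D.\<close>
  have perm: "h D (\<lambda>k\<in>J. g (map_prod id (Transposition.transpose j D) k)) = h j g" if j: "j < Suc D" for j g
  proof -
    let ?t = "Transposition.transpose j D" let ?g = "\<lambda>k\<in>J. g (map_prod id ?t k)"
    have tp: "?t permutes {0..<Suc D}" using j by (intro permutes_swap_id) auto
    have "ridge e (mat N (Suc D) ?g) = ridge e (mat N (Suc D) g)"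
    proof (rule eq_matI)
      fix a b assume "a < dim_row (ridge e (mat N (Suc D) g))" "b < dim_col (ridge e (mat N (Suc D) g))"
      then have ab: "a < N" "b < N" by (auto simp: ridge_def)
      have "(\<Sum>k\<in>{0..<Suc D}. ?g (a, k) * ?g (b, k)) = (\<Sum>k\<in>{0..<Suc D}. g (a, ?t k) * g (b, ?t k))"
        using ab by (intro sum.cong) (auto simp: J_def)
      also have "\<dots> = (\<Sum>k\<in>{0..<Suc D}. g (a, k) * g (b, k))"
        using sum.permute[OF tp, of "\<lambda>k. g (a, k) * g (b, k)"] by (simp add: o_def)
      finally show "ridge e (mat N (Suc D) ?g) $$ (a, b) = ridge e (mat N (Suc D) g) $$ (a, b)"
        using ab by (simp add: ridge_def scalar_prod_def del: sum.op_ivl_Suc)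
    qed (auto simp: ridge_def)
    then have "T ?g = T g" by (simp add: T_def)
    moreover have "col D ?g = col j g"
      by (intro eq_vecI) (auto simp: col_def J_def)
    ultimately show ?thesis by (simp add: h_def)
  qed
  have hj: "(\<integral>g. h j g \<partial>gauss J) = (\<integral>g. h D g \<partial>gauss J)" if j: "j < Suc D" for j
  proof -
    have "map_prod id (Transposition.transpose j D) \<in> J \<rightarrow> J"
      using j by (auto simp: J_def Transposition.transpose_def)
    moreover have "inj_on (map_prod id (Transposition.transpose j D)) J"
      by (rule inj_on_subset[OF map_prod_inj_on[of id UNIV "Transposition.transpose j D" UNIV]]) auto
    ultimately show ?thesis
      using integral_gauss_reindex[OF _ _ mh[of D], of "map_prod id (Transposition.transpose j D)"] perm[OF j] by simp
  qed
  \<comment> \<open>For column D the leverage is q / (1 + q) with q \<ge> 0, hence at most 1; the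
    swap carries this bound to every column.\<close>
  have inth: "integrable (gauss J) (h j)" if j: "j < Suc D" for j
  proof (rule integrable_gauss_bounded[OF mh[OF j]])
    show "\<bar>h j g\<bar> \<le> 1" for g unfolding perm[OF j, symmetric] by (rule h01)
  qed
  have intT: "integrable (gauss J) (\<lambda>g. T g $$ (i, i))" if i: "i < N" for i
    unfolding T_def
    by (rule integrable_gauss_bounded[OF mat_measurable_entry[OF mT i i, unfolded T_def]
          mat_inv_ridge_entry_bound[OF mat_carrier e i i]])
  have sum_h: "(\<Sum>j<Suc D. h j g) = real N - e * tr g" for g
  proof -
    have "(\<Sum>j<Suc D. h j g) = (\<Sum>j<Suc D. Matrix.col (mat N (Suc D) g) j \<bullet> (T g *\<^sub>v Matrix.col (mat N (Suc D) g) j))"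
      by (intro sum.cong) (auto simp: h_def col_def col_mat)
    also have "\<dots> = real N - e * tr g"
      unfolding T_def tr_def by (rule sum_col_mat_inv_ridge[OF _ e]) simp
    finally show ?thesis .
  qed
  have "(real D + 1) * (\<integral>g. h D g \<partial>gauss J) = (\<Sum>j<Suc D. \<integral>g. h j g \<partial>gauss J)"
  proof -
    have "(\<Sum>j<Suc D. \<integral>g. h j g \<partial>gauss J) = (\<Sum>j<Suc D. \<integral>g. h D g \<partial>gauss J)"
      by (intro sum.cong refl hj) simp
    then show ?thesis by (simp add: algebra_simps del: sum.lessThan_Suc)
  qed
  also have "\<dots> = (\<integral>g. real N - e * tr g \<partial>gauss J)"
    unfolding sum_h[symmetric] using inth by (intro Bochner_Integration.integral_sum[symmetric]) auto
  also have "\<dots> = real N - e * (\<Sum>i<N. \<integral>g. T g $$ (i, i) \<partial>gauss J)"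
  proof -
    have "integrable (gauss J) (\<lambda>g. tr g)" unfolding tr_def using intT by (intro Bochner_Integration.integrable_sum) auto
    moreover have "(\<integral>g. tr g \<partial>gauss J) = (\<Sum>i<N. \<integral>g. T g $$ (i, i) \<partial>gauss J)"
      unfolding tr_def using intT by (intro Bochner_Integration.integral_sum) auto
    moreover have "integrable (gauss J) (\<lambda>_. real N)" by (rule integrable_gauss_bounded[of _ _ "real N"]) auto
    ultimately show ?thesis using prob_space.prob_space[OF prob_space_gauss[of J]] by simp
  qed
  also have "\<dots> \<ge> real N - e * (\<Sum>i<N. 1 / (real D - real N))"
  proof -
    \<comment> \<open>The matrix has D + 1 columns here, so the bound 1 / ((D + 1) - N - 1) becomes
      1 / (D - N).\<close>
    have "(\<integral>g. T g $$ (i, i) \<partial>gauss J) \<le> 1 / (real D - real N)" if "i < N" for i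
      using integral_mat_inv_diag_le[OF J e that] ND by (simp add: T_def)
    then have "(\<Sum>i<N. \<integral>g. T g $$ (i, i) \<partial>gauss J) \<le> (\<Sum>i<N. 1 / (real D - real N))"
      by (intro sum_mono) auto
    then have "e * (\<Sum>i<N. \<integral>g. T g $$ (i, i) \<partial>gauss J) \<le> e * (\<Sum>i<N. 1 / (real D - real N))"
      using e by (intro mult_left_mono) auto
    then show ?thesis by linarith
  qed
  finally have "real N - e * (real N / (real D - real N)) \<le> (real D + 1) * (\<integral>g. h D g \<partial>gauss J)" by simp
  then show ?thesis unfolding hD by (simp add: divide_le_eq mult.commute)
qed

section \<open>Removing the regularization\<close>

lemma ridge_0: "X \<in> carrier_mat N D \<Longrightarrow> ridge 0 X = X * transpose_mat X"
  by (intro eq_matI) (auto simp: ridge_def)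

lemma l2_norm_eq_sqrt: "l2_norm v = sqrt (v \<bullet> v)"
  by (simp add: l2_norm_def L2_set_def scalar_prod_def atLeast0LessThan power2_eq_square)

definition pinv_norm :: "nat \<Rightarrow> nat \<Rightarrow> (nat \<times> nat \<Rightarrow> real) \<Rightarrow> real" where
  "pinv_norm N D g = l2_norm (pinv (mat N D g) *\<^sub>v Matrix.vec N (\<lambda>a. g (a, D)))"

lemma pinv_norm_nonneg: "0 \<le> pinv_norm N D g"
  by (simp add: pinv_norm_def l2_norm_def L2_set_nonneg)

lemma pinv_norm_eq:
  fixes g :: "nat \<times> nat \<Rightarrow> real" and N D :: nat
  defines "t \<equiv> transpose_mat (mat N D g) *\<^sub>v (mat_inv (ridge 0 (mat N D g)) *\<^sub>v Matrix.vec N (\<lambda>a. g (a, D)))"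
  shows "pinv_norm N D g = sqrt (t \<bullet> t)"
proof -
  have X: "mat N D g \<in> carrier_mat N D" by (rule mat_carrier)
  have B: "mat_inv (ridge 0 (mat N D g)) \<in> carrier_mat N N" by (rule mat_inv_carrier[OF ridge_carrier[OF X]])
  have "pinv (mat N D g) *\<^sub>v Matrix.vec N (\<lambda>a. g (a, D)) = t"
    unfolding pinv_def ridge_0[OF X, symmetric] t_def
    by (rule assoc_mult_mat_vec[of _ D N _ N]) (use X B in auto)
  then show ?thesis by (simp add: pinv_norm_def l2_norm_eq_sqrt)
qed

lemma pinv_norm_measurable:
  assumes "{..<N} \<times> {..<Suc D} \<subseteq> J"
  shows "pinv_norm N D \<in> borel_measurable (gauss J)"
proof -
  have s: "{..<N} \<times> {..<D} \<subseteq> J" using assms by auto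
  note X = mat_measurable_gauss[OF s]
  have w: "vec_measurable (gauss J) N (\<lambda>g. Matrix.vec N (\<lambda>a. g (a, D)))"
    using assms by (intro vec_measurable_gauss) auto
  note t = mult_mat_vec_measurable[OF mat_measurable_transpose[OF X]
      mult_mat_vec_measurable[OF mat_inv_measurable[OF ridge_measurable[OF X, of 0]] w]]
  have "(\<lambda>g. pinv_norm N D g) \<in> borel_measurable (gauss J)"
    unfolding pinv_norm_eq using scalar_prod_measurable[OF t t] by simp
  then show ?thesis by simp
qed

text \<open>The indicator of a singular X X^T is at most e times the trace of the inverse ridge
  matrix. The mean of that trace is bounded independently of e, so the probability is at most a
  fixed multiple of every e > 0.\<close>

lemma AE_det_ridge_0:
  assumes J: "finite J" "{..<N} \<times> {..<D} \<subseteq> J" and ND: "N + 1 < D"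
  shows "AE g in gauss J. det (ridge 0 (mat N D g)) \<noteq> 0"
proof -
  define f :: "(nat \<times> nat \<Rightarrow> real) \<Rightarrow> real" where "f g = (if det (ridge 0 (mat N D g)) = 0 then 1 else 0)" for g
  have [measurable]: "(\<lambda>g. det (ridge 0 (mat N D g))) \<in> borel_measurable (gauss J)"
    by (rule det_measurable[OF ridge_measurable[OF mat_measurable_gauss[OF J(2)]]])
  have intf: "integrable (gauss J) f"
    by (rule integrable_gauss_bounded[of _ _ 1]) (auto simp: f_def[abs_def])
  define C where "C = real N / (real D - real N - 1)"
  have C: "0 \<le> C" using ND by (simp add: C_def)
  have le: "(\<integral>g. f g \<partial>gauss J) \<le> e * C" if e: "0 < e" for e
  proof -
    let ?B = "\<lambda>g i. mat_inv (ridge e (mat N D g)) $$ (i, i)"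
    have intB: "integrable (gauss J) (\<lambda>g. ?B g i)" if i: "i < N" for i
      by (rule integrable_gauss_bounded[OF mat_measurable_entry[OF mat_inv_measurable[OF
                ridge_measurable[OF mat_measurable_gauss[OF J(2)]]] i i] mat_inv_ridge_entry_bound[OF mat_carrier e i i]])
    have "f g \<le> e * (\<Sum>i<N. ?B g i)" for g
    proof (cases "det (ridge 0 (mat N D g)) = 0")
      case True
      then show ?thesis using trace_mat_inv_ridge_singular[OF mat_carrier True e] e by (simp add: f_def field_simps)
    next
      case False
      have "0 \<le> ?B g i" if "i < N" for i
        using mat_inv_ridge_nonneg[OF mat_carrier[of N D g] e unit_vec_carrier[of N i]]
          mat_entry_unit_vec[OF mat_inv_carrier[OF ridge_carrier[OF mat_carrier[of N D g]]] that that, of e] by simp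
      then have "0 \<le> (\<Sum>i<N. ?B g i)" by (intro sum_nonneg) auto
      then show ?thesis using False e by (simp add: f_def)
    qed
    then have "(\<integral>g. f g \<partial>gauss J) \<le> (\<integral>g. e * (\<Sum>i<N. ?B g i) \<partial>gauss J)"
      using intf intB by (intro integral_mono integrable_mult_right Bochner_Integration.integrable_sum) auto
    also have "\<dots> = e * (\<Sum>i<N. \<integral>g. ?B g i \<partial>gauss J)"
      using intB by (simp add: Bochner_Integration.integral_sum)
    also have "\<dots> \<le> e * (\<Sum>i<N. 1 / (real D - real N - 1))"
      using e integral_mat_inv_diag_le[OF J e _ ND] by (intro mult_left_mono sum_mono) auto
    finally show ?thesis by (simp add: C_def)
  qed
  have "(\<integral>g. f g \<partial>gauss J) \<le> 0"
  proof (rule field_le_epsilon)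
    fix x :: real assume x: "0 < x"
    \<comment> \<open>The divisor C + 1 keeps e = x / (C + 1) positive also when C = 0.\<close>
    then have "(\<integral>g. f g \<partial>gauss J) \<le> x / (C + 1) * C" using C by (intro le) auto
    also have "\<dots> \<le> x" using x C by (simp add: field_simps)
    finally show "(\<integral>g. f g \<partial>gauss J) \<le> 0 + x" by simp
  qed
  moreover have "0 \<le> (\<integral>g. f g \<partial>gauss J)" by (intro integral_nonneg_AE) (auto simp: f_def)
  ultimately have "(\<integral>g. f g \<partial>gauss J) = 0" by simp
  moreover have "AE g in gauss J. 0 \<le> f g" by (simp add: f_def)
  ultimately have "AE g in gauss J. f g = 0"
    using integral_nonneg_eq_0_iff_AE[OF intf] by blast
  then show ?thesis by eventually_elim (auto simp: f_def split: if_splits)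
qed

text \<open>At e = 0 the quadratic identity turns V^2 = |X^T z|^2 into w . z with z = (X X^T)^-1 w,
  and the regularized form differs from it by at most e |z|^2.\<close>

lemma ridge_form_tendsto:
  assumes d: "det (ridge 0 (mat N D g)) \<noteq> 0"
  shows "(\<lambda>n. ridge_form (1 / real (Suc n)) N D g) \<longlonglongrightarrow> (pinv_norm N D g)\<^sup>2"
proof -
  let ?X = "mat N D g" let ?w = "Matrix.vec N (\<lambda>a. g (a, D))"
  have X: "?X \<in> carrier_mat N D" by (rule mat_carrier)
  have w: "?w \<in> carrier_vec N" by simp
  define z where "z = mat_inv (ridge 0 ?X) *\<^sub>v ?w"
  have sq: "(pinv_norm N D g)\<^sup>2 = ?w \<bullet> z"
    using mat_inv_ridge_quadratic[OF X d w] by (simp add: pinv_norm_eq z_def scalar_prod_self_nonneg)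
  have "(\<lambda>n. ridge_form (1 / real (Suc n)) N D g - ?w \<bullet> z) \<longlonglongrightarrow> 0"
  proof (rule Lim_null_comparison)
    show "\<forall>\<^sub>F n in sequentially. norm (ridge_form (1 / real (Suc n)) N D g - ?w \<bullet> z) \<le> 1 / real (Suc n) * (z \<bullet> z)"
    proof (intro always_eventually allI)
      show "norm (ridge_form (1 / real (Suc n)) N D g - ?w \<bullet> z) \<le> 1 / real (Suc n) * (z \<bullet> z)" for n
        using mat_inv_ridge_limit[OF X d _ w, of "1 / real (Suc n)"]
        by (simp add: ridge_form_def z_def del: of_nat_Suc)
    qed
    show "(\<lambda>n. 1 / real (Suc n) * (z \<bullet> z)) \<longlonglongrightarrow> 0"
      using tendsto_mult_left_zero[OF LIMSEQ_inverse_real_of_nat] by (simp add: inverse_eq_divide)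
  qed
  then show ?thesis unfolding sq by (rule LIM_zero_cancel)
qed

text \<open>Fatou's lemma along e = 1 / (n + 1): an upper bound uniform in e passes to the limit
  without a dominating function, and it yields integrability as well.\<close>

lemma integral_pinv_norm_sq_le:
  assumes ND: "N + 1 < D"
  defines "J \<equiv> {..<N} \<times> {..<Suc D}"
  shows "integrable (gauss J) (\<lambda>g. (pinv_norm N D g)\<^sup>2)"
    and "(\<integral>g. (pinv_norm N D g)\<^sup>2 \<partial>gauss J) \<le> real N / (real D - real N - 1)"
proof -
  define C where "C = real N / (real D - real N - 1)"
  have C: "0 \<le> C" using ND by (simp add: C_def)
  have J: "finite J" "{..<N} \<times> {..<D} \<subseteq> J" "{..<N} \<times> {..<Suc D} \<subseteq> J" by (auto simp: J_def)
  note [measurable] = pinv_norm_measurable[OF J(3)]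
  let ?q = "\<lambda>n. ridge_form (1 / real (Suc n)) N D"
  have mq[measurable]: "?q n \<in> borel_measurable (gauss J)" for n by (rule ridge_form_measurable[OF J(3)])
  have "(\<integral>\<^sup>+g. ennreal ((pinv_norm N D g)\<^sup>2) \<partial>gauss J) = (\<integral>\<^sup>+g. liminf (\<lambda>n. ennreal (?q n g)) \<partial>gauss J)"
  proof (rule nn_integral_cong_AE)
    show "AE g in gauss J. ennreal ((pinv_norm N D g)\<^sup>2) = liminf (\<lambda>n. ennreal (?q n g))"
      using AE_det_ridge_0[OF J(1,2) ND]
    proof eventually_elim
      case (elim g)
      have "(\<lambda>n. ennreal (?q n g)) \<longlonglongrightarrow> ennreal ((pinv_norm N D g)\<^sup>2)"
        by (intro tendsto_ennrealI ridge_form_tendsto elim)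
      then show ?case by (simp add: lim_imp_Liminf)
    qed
  qed
  also have "\<dots> \<le> liminf (\<lambda>n. \<integral>\<^sup>+g. ennreal (?q n g) \<partial>gauss J)"
    by (intro nn_integral_liminf) measurable
  also have "\<dots> \<le> ennreal C"
  proof (rule Liminf_le)
    show "\<forall>\<^sub>F n in sequentially. (\<integral>\<^sup>+g. ennreal (?q n g) \<partial>gauss J) \<le> ennreal C"
    proof (intro always_eventually allI)
      fix n
      have e: "0 < 1 / real (Suc n)" by simp
      have "(\<integral>\<^sup>+g. ennreal (?q n g) \<partial>gauss J) = ennreal (\<integral>g. ?q n g \<partial>gauss J)"
        using integral_ridge_form_le(1)[OF e ND] ridge_form_nonneg[OF e]
        by (intro nn_integral_eq_integral) (auto simp: J_def)
      also have "\<dots> \<le> ennreal C"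
        using integral_ridge_form_le(2)[OF e ND] by (intro ennreal_leI) (simp add: C_def J_def)
      finally show "(\<integral>\<^sup>+g. ennreal (?q n g) \<partial>gauss J) \<le> ennreal C" .
    qed
  qed simp
  finally have le: "(\<integral>\<^sup>+g. ennreal ((pinv_norm N D g)\<^sup>2) \<partial>gauss J) \<le> ennreal C" .
  then show int: "integrable (gauss J) (\<lambda>g. (pinv_norm N D g)\<^sup>2)"
    by (intro integrableI_nonneg) (auto intro: le_less_trans)
  have "ennreal (\<integral>g. (pinv_norm N D g)\<^sup>2 \<partial>gauss J) \<le> ennreal C"
    using le nn_integral_eq_integral[OF int] by simp
  then show "(\<integral>g. (pinv_norm N D g)\<^sup>2 \<partial>gauss J) \<le> real N / (real D - real N - 1)"
    using C by (simp add: C_def)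
qed

text \<open>Here the limit must preserve a lower bound; the ratio never exceeds 1, so dominated
  convergence applies, and the correction of order e disappears.\<close>

lemma integral_pinv_norm_ratio_ge:
  assumes ND: "N + 1 < D"
  defines "J \<equiv> {..<N} \<times> {..<Suc D}"
  shows "real N / (real D + 1) \<le> (\<integral>g. (pinv_norm N D g)\<^sup>2 / (1 + (pinv_norm N D g)\<^sup>2) \<partial>gauss J)"
proof -
  have J: "finite J" "{..<N} \<times> {..<D} \<subseteq> J" "{..<N} \<times> {..<Suc D} \<subseteq> J" by (auto simp: J_def)
  note [measurable] = pinv_norm_measurable[OF J(3)]
  let ?q = "\<lambda>n. ridge_form (1 / real (Suc n)) N D"
  have q0: "0 \<le> ?q n g" for n g by (intro ridge_form_nonneg) simp
  have mq[measurable]: "?q n \<in> borel_measurable (gauss J)" for n by (rule ridge_form_measurable[OF J(3)])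
  have lim: "(\<lambda>n. \<integral>g. ?q n g / (1 + ?q n g) \<partial>gauss J)
      \<longlonglongrightarrow> (\<integral>g. (pinv_norm N D g)\<^sup>2 / (1 + (pinv_norm N D g)\<^sup>2) \<partial>gauss J)"
  proof (rule integral_dominated_convergence[where w = "\<lambda>_. 1"])
    show "AE g in gauss J. (\<lambda>n. ?q n g / (1 + ?q n g)) \<longlonglongrightarrow> (pinv_norm N D g)\<^sup>2 / (1 + (pinv_norm N D g)\<^sup>2)"
      using AE_det_ridge_0[OF J(1,2) ND]
    proof eventually_elim
      case (elim g)
      have "1 + (pinv_norm N D g)\<^sup>2 \<noteq> 0" by (smt (verit) zero_le_power2)
      then show ?case by (intro tendsto_intros ridge_form_tendsto elim) 
    qed
    show "integrable (gauss J) (\<lambda>_. 1 :: real)" by (rule integrable_gauss_bounded[of _ _ 1]) auto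
    show "AE g in gauss J. norm (?q n g / (1 + ?q n g)) \<le> 1" for n
    proof (intro AE_I2)
      fix g
      show "norm (?q n g / (1 + ?q n g)) \<le> 1" using q0[of n g] by (simp add: abs_divide abs_of_nonneg divide_le_eq del: of_nat_Suc)
    qed
  qed measurable
  have lo: "(\<lambda>n. (real N - 1 / real (Suc n) * (real N / (real D - real N))) / (real D + 1)) \<longlonglongrightarrow> (real N - 0) / (real D + 1)"
    using tendsto_mult_left_zero[OF LIMSEQ_inverse_real_of_nat, of "real N / (real D - real N)"]
    by (intro tendsto_intros) (auto simp: inverse_eq_divide)
  have le: "(real N - 1 / real (Suc n) * (real N / (real D - real N))) / (real D + 1)
      \<le> (\<integral>g. ?q n g / (1 + ?q n g) \<partial>gauss J)" for n
    unfolding J_def by (rule integral_ridge_form_ratio_ge) (use ND in auto)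
  have "(real N - 0) / (real D + 1) \<le> (\<integral>g. (pinv_norm N D g)\<^sup>2 / (1 + (pinv_norm N D g)\<^sup>2) \<partial>gauss J)"
    by (rule LIMSEQ_le[OF lo lim]) (use le in blast)
  then show ?thesis by simp
qed

section \<open>From two moments to the mean\<close>

text \<open>Pointwise, V lies below the tangent at c^2 to the square root as a function of V^2, and
  above an affine combination of V^2 and V^2 / (1 + V^2) that touches it at V = c. Since m \<le> 1,
  the coefficient of V^2 in the latter is nonpositive, and that of the ratio is nonnegative, so an
  upper bound a and a lower bound b are what is needed. For a = c^2 and b = c^2 / (1 + c^2) both
  conclusions give c.\<close>

lemma prob_space_expectation_bounds:
  fixes V :: "'b \<Rightarrow> real"
  assumes "prob_space P" and c: "0 < c" and [measurable]: "V \<in> borel_measurable P" and V0: "\<And>x. 0 \<le> V x"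
    and int2: "integrable P (\<lambda>x. (V x)\<^sup>2)"
    and a: "(\<integral>x. (V x)\<^sup>2 \<partial>P) \<le> a"
    and b: "b \<le> (\<integral>x. (V x)\<^sup>2 / (1 + (V x)\<^sup>2) \<partial>P)"
  defines "m \<equiv> min 1 (c\<^sup>2)"
  shows "(\<integral>x. V x \<partial>P) \<le> c + (a - c\<^sup>2) / (2 * c)"
    and "c + (1 - 1 / m) / (2 * c) * (a - c\<^sup>2) + (1 + c\<^sup>2)\<^sup>2 / (2 * c * m) * (b - c\<^sup>2 / (1 + c\<^sup>2)) \<le> (\<integral>x. V x \<partial>P)"
proof -
  interpret prob_space P by fact
  let ?r = "\<lambda>x. (V x)\<^sup>2 / (1 + (V x)\<^sup>2)"
  have m: "0 < m" "m \<le> 1" "m \<le> c\<^sup>2" using c by (auto simp: m_def)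
  have intV: "integrable P V"
  proof (rule Bochner_Integration.integrable_bound)
    show "integrable P (\<lambda>x. 1 + (V x)\<^sup>2)" using int2 by simp
    show "AE x in P. norm (V x) \<le> norm (1 + (V x)\<^sup>2)"
    proof (intro AE_I2)
      fix x
      have "2 * V x \<le> 1 + (V x)\<^sup>2" using zero_le_power2[of "V x - 1"] by (simp add: power2_diff)
      then show "norm (V x) \<le> norm (1 + (V x)\<^sup>2)" using V0[of x] by simp
    qed
  qed measurable
  have intr: "integrable P ?r"
  proof (rule integrable_const_bound[of _ 1])
    show "AE x in P. norm (?r x) \<le> 1"
      by (intro AE_I2) (simp add: divide_le_eq_1 add_pos_nonneg abs_of_nonneg)
  qed measurable
  have "(\<integral>x. V x \<partial>P) \<le> (\<integral>x. c + ((V x)\<^sup>2 - c\<^sup>2) / (2 * c) \<partial>P)"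
  proof (rule integral_mono[OF intV])
    show "integrable P (\<lambda>x. c + ((V x)\<^sup>2 - c\<^sup>2) / (2 * c))" using int2 by simp
    fix x
    have "0 \<le> (V x - c)\<^sup>2" by simp
    then show "V x \<le> c + ((V x)\<^sup>2 - c\<^sup>2) / (2 * c)"
      using c by (simp add: power2_eq_square field_simps)
  qed
  also have "\<dots> = c + ((\<integral>x. (V x)\<^sup>2 \<partial>P) - c\<^sup>2) / (2 * c)"
    using int2 by (simp add: prob_space)
  also have "\<dots> \<le> c + (a - c\<^sup>2) / (2 * c)" using a c by (simp add: divide_right_mono)
  finally show "(\<integral>x. V x \<partial>P) \<le> c + (a - c\<^sup>2) / (2 * c)" .
  let ?\<alpha> = "(1 - 1 / m) / (2 * c)" and ?\<beta> = "(1 + c\<^sup>2)\<^sup>2 / (2 * c * m)"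
  have "?\<alpha> \<le> 0" using m c by (intro divide_nonpos_pos) (auto simp: field_simps)
  then have 1: "?\<alpha> * (a - c\<^sup>2) \<le> ?\<alpha> * ((\<integral>x. (V x)\<^sup>2 \<partial>P) - c\<^sup>2)" using a by (intro mult_left_mono_neg) auto
  have "0 \<le> ?\<beta>" using m c by simp
  then have 2: "?\<beta> * (b - c\<^sup>2 / (1 + c\<^sup>2)) \<le> ?\<beta> * ((\<integral>x. ?r x \<partial>P) - c\<^sup>2 / (1 + c\<^sup>2))" using b by (intro mult_left_mono) auto
  have "c + ?\<alpha> * ((\<integral>x. (V x)\<^sup>2 \<partial>P) - c\<^sup>2) + ?\<beta> * ((\<integral>x. ?r x \<partial>P) - c\<^sup>2 / (1 + c\<^sup>2))
      = (\<integral>x. c + ?\<alpha> * ((V x)\<^sup>2 - c\<^sup>2) + ?\<beta> * (?r x - c\<^sup>2 / (1 + c\<^sup>2)) \<partial>P)"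
    using int2 intr by (simp add: prob_space)
  also have "\<dots> \<le> (\<integral>x. V x \<partial>P)"
  proof (rule integral_mono[OF _ intV])
    show "integrable P (\<lambda>x. c + ?\<alpha> * ((V x)\<^sup>2 - c\<^sup>2) + ?\<beta> * (?r x - c\<^sup>2 / (1 + c\<^sup>2)))"
      using int2 intr by simp
    fix x
    define s where "s = V x"
    have s: "0 \<le> s" using V0 by (simp add: s_def)
    have p: "0 < 1 + s\<^sup>2" "0 < 1 + c\<^sup>2" by (simp_all add: add_pos_nonneg)
    define d where "d = s\<^sup>2 / (1 + s\<^sup>2) - c\<^sup>2 / (1 + c\<^sup>2)"
    \<comment> \<open>The error (s - c)^2 / (2 c) of the tangent to the square root is controlled by the gap between
      s^2 - c^2 and the linearization of s^2 / (1 + s^2).\<close>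
    have "m * (1 + s\<^sup>2) \<le> (s + c)\<^sup>2"
    proof -
      \<comment> \<open>The choice of m as the minimum of 1 and c^2 makes m (1 + s^2) \<le> s^2 +
        c^2; the mixed term 2 s c of the square is dropped.\<close>
      have "m * s\<^sup>2 \<le> 1 * s\<^sup>2" using m by (intro mult_right_mono) auto
      moreover have "0 \<le> s * c" using s c by simp
      ultimately show ?thesis using m by (simp add: power2_sum algebra_simps)
    qed
    then have "m * (1 + s\<^sup>2) * (s - c)\<^sup>2 \<le> (s + c)\<^sup>2 * (s - c)\<^sup>2" by (intro mult_right_mono) auto
    also have "\<dots> = (s\<^sup>2 - c\<^sup>2)\<^sup>2" by (simp add: power2_eq_square algebra_simps)
    finally have "m * (s - c)\<^sup>2 \<le> (s\<^sup>2 - c\<^sup>2)\<^sup>2 / (1 + s\<^sup>2)" using p by (simp add: pos_le_divide_eq algebra_simps)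
    \<comment> \<open>The function t / (1 + t) has slope 1 / (1 + c^2)^2 at t = c^2. Rescaling d by
      the inverse slope leaves exactly this quadratic remainder.\<close>
    also have "\<dots> = (s\<^sup>2 - c\<^sup>2) - (1 + c\<^sup>2)\<^sup>2 * d"
    proof -
      have d: "d = (s\<^sup>2 - c\<^sup>2) / ((1 + s\<^sup>2) * (1 + c\<^sup>2))"
        using p by (simp add: d_def diff_frac_eq) (simp add: algebra_simps)
      have "(1 + c\<^sup>2)\<^sup>2 * d = (1 + c\<^sup>2) * (s\<^sup>2 - c\<^sup>2) / (1 + s\<^sup>2)"
        unfolding d using p by (simp add: power2_eq_square[of "1 + c\<^sup>2"])
      moreover have "(s\<^sup>2 - c\<^sup>2)\<^sup>2 / (1 + s\<^sup>2) = ((1 + s\<^sup>2) * (s\<^sup>2 - c\<^sup>2) - (1 + c\<^sup>2) * (s\<^sup>2 - c\<^sup>2)) / (1 + s\<^sup>2)"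
        by (simp add: power2_eq_square[of "s\<^sup>2 - c\<^sup>2"] flip: left_diff_distrib)
      moreover have "(1 + s\<^sup>2) * (s\<^sup>2 - c\<^sup>2) / (1 + s\<^sup>2) = s\<^sup>2 - c\<^sup>2"
        using p(1) by (intro nonzero_mult_div_cancel_left) simp
      ultimately show ?thesis by (simp only: diff_divide_distrib)
    qed
    finally have "(s - c)\<^sup>2 \<le> ((s\<^sup>2 - c\<^sup>2) - (1 + c\<^sup>2)\<^sup>2 * d) / m" using m by (simp add: field_simps)
    then have "(s - c)\<^sup>2 / (2 * c) \<le> ((s\<^sup>2 - c\<^sup>2) - (1 + c\<^sup>2)\<^sup>2 * d) / m / (2 * c)" using c by (intro divide_right_mono) auto
    moreover have "s = c + (s\<^sup>2 - c\<^sup>2) / (2 * c) - (s - c)\<^sup>2 / (2 * c)"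
      using c by (simp add: field_simps power2_eq_square)
    moreover have "?\<alpha> * (s\<^sup>2 - c\<^sup>2) + ?\<beta> * d = (s\<^sup>2 - c\<^sup>2) / (2 * c) - ((s\<^sup>2 - c\<^sup>2) - (1 + c\<^sup>2)\<^sup>2 * d) / m / (2 * c)"
      by (simp add: diff_divide_distrib add_divide_distrib algebra_simps)
    ultimately have "c + ?\<alpha> * (s\<^sup>2 - c\<^sup>2) + ?\<beta> * d \<le> s" by linarith
    then show "c + ?\<alpha> * ((V x)\<^sup>2 - c\<^sup>2) + ?\<beta> * (?r x - c\<^sup>2 / (1 + c\<^sup>2)) \<le> V x"
      by (simp add: s_def d_def)
  qed
  finally show "c + (1 - 1 / m) / (2 * c) * (a - c\<^sup>2) + (1 + c\<^sup>2)\<^sup>2 / (2 * c * m) * (b - c\<^sup>2 / (1 + c\<^sup>2)) \<le> (\<integral>x. V x \<partial>P)"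
    using 1 2 by linarith
qed

section \<open>Reduction to the canonical Gaussian measure\<close>

lemma distributed_std_normal:
  assumes "distributed M lborel Z std_normal_density"
  shows "distr M borel Z = std_normal" "Z \<in> borel_measurable M"
proof -
  show "Z \<in> borel_measurable M"
    using assms by (simp add: distributed_def)
  have "distr M borel Z = distr M lborel Z" by (rule distr_cong) auto
  also have "\<dots> = std_normal"
    using assms by (simp add: distributed_def std_normal_def)
  finally show "distr M borel Z = std_normal" .
qed

lemma iid_std_normal_prob_box:
  assumes M: "prob_space M" and Z: "iid_std_normal M Z I" and I: "finite I" "I \<noteq> {}"
    and A: "\<And>k. k \<in> I \<Longrightarrow> A k \<in> sets borel"
  shows "measure M {s \<in> space M. \<forall>k\<in>I. Z k s \<in> A k} = (\<Prod>k\<in>I. measure std_normal (A k))"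
proof -
  interpret prob_space M by fact
  have Zi: "distributed M lborel (Z k) std_normal_density" if "k \<in> I" for k
    using Z that by (simp add: iid_std_normal_def)
  have "{s \<in> space M. \<forall>k\<in>I. Z k s \<in> A k} = (\<Inter>k\<in>I. Z k -` A k \<inter> space M)"
    using I by auto
  then have "measure M {s \<in> space M. \<forall>k\<in>I. Z k s \<in> A k} = (\<Prod>k\<in>I. prob (Z k -` A k \<inter> space M))"
    using indep_varsD_finite[of "\<lambda>_. borel" Z I A] Z I A by (simp add: iid_std_normal_def)
  also have "\<dots> = (\<Prod>k\<in>I. measure std_normal (A k))"
  proof (rule prod.cong)
    fix k assume k: "k \<in> I"
    show "prob (Z k -` A k \<inter> space M) = measure std_normal (A k)"
      using measure_distr[OF distributed_std_normal(2)[OF Zi[OF k]], of "A k"] A[OF k]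
      by (simp add: distributed_std_normal(1)[OF Zi[OF k]])
  qed simp
  finally show ?thesis .
qed

text \<open>The entries of [X | w]: column D holds the noise.\<close>

definition joint_entries :: "nat \<Rightarrow> nat \<Rightarrow> real mat \<Rightarrow> real vec \<Rightarrow> nat \<times> nat \<Rightarrow> real" where
  "joint_entries N D X w = (\<lambda>(i, j)\<in>{..<N} \<times> {..<Suc D}. if j < D then X $$ (i, j) else w $ i)"

text \<open>A finite product measure is determined by its values on boxes. A box for [X | w] is the
  intersection of an event of X with an event of w; independence of the two splits its probability,
  and independence of the entries splits each factor. Positive N and D make both index sets
  nonempty, as \<open>iid_std_normal_prob_box\<close> requires.\<close>

lemma distr_joint_entries:
  assumes M: "prob_space M" and ND: "0 < N" "0 < D"
    and X: "gaussian_matrix M N D X" and w: "gaussian_vector M N w" and ind: "indep_mat_vec M N D X w"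
  defines "J \<equiv> {..<N} \<times> {..<Suc D}"
  shows "(\<lambda>s. joint_entries N D (X s) (w s)) \<in> M \<rightarrow>\<^sub>M gauss J"
    and "distr M (gauss J) (\<lambda>s. joint_entries N D (X s) (w s)) = gauss J"
proof -
  interpret prob_space M by fact
  let ?I = "{..<N} \<times> {..<D}"
  let ?G = "\<lambda>s. joint_entries N D (X s) (w s)"
  have iX: "iid_std_normal M (\<lambda>(i, j) s. X s $$ (i, j)) ?I" using X by (simp add: gaussian_matrix_def)
  have iw: "iid_std_normal M (\<lambda>i s. w s $ i) {..<N}" using w by (simp add: gaussian_vector_def)
  have mX: "(\<lambda>s. X s $$ (i, j)) \<in> borel_measurable M" if "i < N" "j < D" for i j
    using iX that distributed_std_normal(2)[of M "\<lambda>s. X s $$ (i, j)"] by (auto simp: iid_std_normal_def)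
  have mw: "(\<lambda>s. w s $ i) \<in> borel_measurable M" if "i < N" for i
    using iw that distributed_std_normal(2)[of M "\<lambda>s. w s $ i"] by (auto simp: iid_std_normal_def)
  have meas: "?G \<in> M \<rightarrow>\<^sub>M Pi\<^sub>M J (\<lambda>_. borel)"
    unfolding joint_entries_def J_def
  proof (rule measurable_restrict)
    fix k assume "k \<in> {..<N} \<times> {..<Suc D}"
    then obtain i j where k: "k = (i, j)" "i < N" "j < Suc D" by auto
    show "(\<lambda>s. case k of (i, j) \<Rightarrow> if j < D then X s $$ (i, j) else w s $ i) \<in> borel_measurable M"
      using k mX[of i j] mw[of i] by (cases "j < D") auto
  qed
  moreover have "sets (Pi\<^sub>M J (\<lambda>_. borel)) = sets (gauss J)" by (intro sets_PiM_cong) auto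
  ultimately show meas': "?G \<in> M \<rightarrow>\<^sub>M gauss J" using measurable_cong_sets by blast
  show "distr M (gauss J) ?G = gauss J"
  proof (rule gauss.PiM_eqI)
    show "finite J" by (simp add: J_def)
    show "sets (distr M (gauss J) ?G) = sets (gauss J)" by simp
    fix A assume A: "\<And>k. k \<in> J \<Longrightarrow> A k \<in> sets std_normal"
    then have A': "A k \<in> sets borel" if "k \<in> J" for k using that by simp
    define E1 where "E1 = {s \<in> space M. \<forall>k\<in>?I. (\<lambda>(i, j) s. X s $$ (i, j)) k s \<in> A k}"
    define E2 where "E2 = {s \<in> space M. \<forall>i\<in>{..<N}. w s $ i \<in> A (i, D)}"
    have split: "?G -` (Pi\<^sub>E J A) \<inter> space M = E1 \<inter> E2"
    proof (intro equalityI subsetI)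
      fix s assume "s \<in> ?G -` (Pi\<^sub>E J A) \<inter> space M"
      then have s: "s \<in> space M" and *: "\<And>k. k \<in> J \<Longrightarrow> ?G s k \<in> A k" by (auto simp: PiE_iff)
      have "X s $$ (i, j) \<in> A (i, j)" if "i < N" "j < D" for i j
        using *[of "(i, j)"] that by (simp add: joint_entries_def J_def)
      moreover have "w s $ i \<in> A (i, D)" if "i < N" for i
        using *[of "(i, D)"] that by (simp add: joint_entries_def J_def)
      ultimately show "s \<in> E1 \<inter> E2" using s by (auto simp: E1_def E2_def)
    next
      fix s assume "s \<in> E1 \<inter> E2"
      then show "s \<in> ?G -` (Pi\<^sub>E J A) \<inter> space M"
        by (auto simp: E1_def E2_def joint_entries_def J_def less_Suc_eq)
    qed
    \<comment> \<open>Independence is stated for the generated sigma-algebras, so the event has to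
      be exhibited as the preimage of a box under the entry family.\<close>
    have E1: "E1 \<in> sets (vimage_algebra (space M) (\<lambda>s. \<lambda>(i, j)\<in>?I. X s $$ (i, j)) (Pi\<^sub>M ?I (\<lambda>_. borel)))"
    proof -
      have "Pi\<^sub>E ?I A \<in> sets (Pi\<^sub>M ?I (\<lambda>_. borel))"
        using A' by (intro sets_PiM_I_finite) (auto simp: J_def)
      then have "(\<lambda>s. \<lambda>(i, j)\<in>?I. X s $$ (i, j)) -` (Pi\<^sub>E ?I A) \<inter> space M
          \<in> sets (vimage_algebra (space M) (\<lambda>s. \<lambda>(i, j)\<in>?I. X s $$ (i, j)) (Pi\<^sub>M ?I (\<lambda>_. borel)))"
        by (rule in_vimage_algebra)
      moreover have "(\<lambda>s. \<lambda>(i, j)\<in>?I. X s $$ (i, j)) -` (Pi\<^sub>E ?I A) \<inter> space M = E1"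
        unfolding E1_def by (simp only: set_eq_iff vimage_eq Int_iff mem_Collect_eq restrict_PiE_iff) (simp add: case_prod_unfold conj_commute)
      ultimately show ?thesis by simp
    qed
    have E2: "E2 \<in> sets (vimage_algebra (space M) (\<lambda>s. \<lambda>i\<in>{..<N}. w s $ i) (Pi\<^sub>M {..<N} (\<lambda>_. borel)))"
    proof -
      have "Pi\<^sub>E {..<N} (\<lambda>i. A (i, D)) \<in> sets (Pi\<^sub>M {..<N} (\<lambda>_. borel))"
        using A' by (intro sets_PiM_I_finite) (auto simp: J_def)
      then have "(\<lambda>s. \<lambda>i\<in>{..<N}. w s $ i) -` (Pi\<^sub>E {..<N} (\<lambda>i. A (i, D))) \<inter> space M
          \<in> sets (vimage_algebra (space M) (\<lambda>s. \<lambda>i\<in>{..<N}. w s $ i) (Pi\<^sub>M {..<N} (\<lambda>_. borel)))"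
        by (rule in_vimage_algebra)
      moreover have "(\<lambda>s. \<lambda>i\<in>{..<N}. w s $ i) -` (Pi\<^sub>E {..<N} (\<lambda>i. A (i, D))) \<inter> space M = E2"
        unfolding E2_def by (simp only: set_eq_iff vimage_eq Int_iff mem_Collect_eq restrict_PiE_iff) blast
      ultimately show ?thesis by simp
    qed
    have "prob (E1 \<inter> E2) = prob E1 * prob E2"
      using ind E1 E2 unfolding indep_mat_vec_def by (rule indep_setD)
    also have "prob E1 = (\<Prod>k\<in>?I. measure std_normal (A k))"
      unfolding E1_def using A' ND by (intro iid_std_normal_prob_box[OF M iX]) (auto simp: J_def)
    also have "prob E2 = (\<Prod>i\<in>{..<N}. measure std_normal (A (i, D)))"
      unfolding E2_def using A' ND by (intro iid_std_normal_prob_box[OF M iw]) (auto simp: J_def)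
    also have "(\<Prod>k\<in>?I. measure std_normal (A k)) * (\<Prod>i\<in>{..<N}. measure std_normal (A (i, D)))
        = (\<Prod>k\<in>J. measure std_normal (A k))"
      by (simp add: J_def prod.distrib prod.cartesian_product')
    finally have "prob (E1 \<inter> E2) = (\<Prod>k\<in>J. measure std_normal (A k))" .
    moreover have "emeasure (distr M (gauss J) ?G) (Pi\<^sub>E J A) = emeasure M (E1 \<inter> E2)"
      using A \<open>finite J\<close> meas' by (subst emeasure_distr) (auto simp: split intro!: sets_PiM_I_finite)
    ultimately show "emeasure (distr M (gauss J) ?G) (Pi\<^sub>E J A) = (\<Prod>k\<in>J. emeasure std_normal (A k))"
      by (simp add: emeasure_eq_measure std_normal.emeasure_eq_measure prod_ennreal)
  qed
qed

text \<open>By linearity the signal cancels: X^+ (X theta + w) - X^+ X theta = X^+ w, on every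
  sample and whether or not X X^T is invertible. What remains depends only on the joint law of the
  entries.\<close>

lemma expectation_pinv_eq:
  assumes M: "prob_space M" and ND: "0 < N" "0 < D"
    and X: "gaussian_matrix M N D X" and w: "gaussian_vector M N w" and ind: "indep_mat_vec M N D X w"
    and th: "th \<in> carrier_vec D" and y: "\<And>s. s \<in> space M \<Longrightarrow> y s = X s *\<^sub>v th + w s"
  shows "(\<integral>s. l2_norm (pinv (X s) *\<^sub>v y s - pinv (X s) *\<^sub>v (X s *\<^sub>v th)) \<partial>M)
    = (\<integral>g. pinv_norm N D g \<partial>gauss ({..<N} \<times> {..<Suc D}))"
proof -
  let ?J = "{..<N} \<times> {..<Suc D}"
  note G = distr_joint_entries[OF M ND X w ind]
  have "(\<integral>s. l2_norm (pinv (X s) *\<^sub>v y s - pinv (X s) *\<^sub>v (X s *\<^sub>v th)) \<partial>M)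
      = (\<integral>s. pinv_norm N D (joint_entries N D (X s) (w s)) \<partial>M)"
  proof (rule Bochner_Integration.integral_cong)
    fix s assume s: "s \<in> space M"
    have Xs: "X s \<in> carrier_mat N D" and ws: "w s \<in> carrier_vec N"
      using X w s by (auto simp: gaussian_matrix_def gaussian_vector_def)
    have P: "pinv (X s) \<in> carrier_mat D N"
      unfolding pinv_def ridge_0[OF Xs, symmetric]
      using Xs mat_inv_carrier[OF ridge_carrier[OF Xs]] by auto
    have u: "X s *\<^sub>v th \<in> carrier_vec N" using Xs th by simp
    have "pinv (X s) *\<^sub>v y s - pinv (X s) *\<^sub>v (X s *\<^sub>v th) = pinv (X s) *\<^sub>v w s"
      using mult_add_distrib_mat_vec[OF P u ws] P u ws
      by (intro eq_vecI) (auto simp: y[OF s])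
    moreover have "mat N D (joint_entries N D (X s) (w s)) = X s"
      using Xs by (intro eq_matI) (auto simp: joint_entries_def)
    moreover have "Matrix.vec N (\<lambda>a. joint_entries N D (X s) (w s) (a, D)) = w s"
      using ws by (intro eq_vecI) (auto simp: joint_entries_def)
    ultimately show "l2_norm (pinv (X s) *\<^sub>v y s - pinv (X s) *\<^sub>v (X s *\<^sub>v th)) = pinv_norm N D (joint_entries N D (X s) (w s))"
      by (simp add: pinv_norm_def)
  qed simp
  also have "\<dots> = (\<integral>g. pinv_norm N D g \<partial>distr M (gauss ?J) (\<lambda>s. joint_entries N D (X s) (w s)))"
    using G(1) pinv_norm_measurable[of N D ?J] by (intro integral_distr[symmetric]) auto
  finally show ?thesis by (simp add: G(2))
qed

section \<open>The limit at fixed ratio\<close>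

text \<open>On ratio pairs N is determined by D, so the bounds become sequences in D; this carries
  their limits over to the filter on pairs.\<close>

lemma ratio_filter_snd: "filterlim snd at_top (ratio_filter lam)"
  unfolding ratio_filter_def
  by (rule filterlim_mono[OF filterlim_snd order_refl inf_le1])

theorem mainTheorem1:
  fixes lam :: real
    and M :: "nat \<Rightarrow> nat \<Rightarrow> 'a measure"
    and X :: "nat \<Rightarrow> nat \<Rightarrow> 'a \<Rightarrow> real mat"
    and theta :: "nat \<Rightarrow> nat \<Rightarrow> real vec"
    and w y :: "nat \<Rightarrow> nat \<Rightarrow> 'a \<Rightarrow> real vec"
  assumes "0 < lam" and "lam < 1"
    and "\<And>N D. (N, D) \<in> ratio_pairs lam \<Longrightarrow> prob_space (M N D)"
    and "\<And>N D. (N, D) \<in> ratio_pairs lam \<Longrightarrow> gaussian_matrix (M N D) N D (X N D)"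
    and "\<And>N D. (N, D) \<in> ratio_pairs lam \<Longrightarrow> theta N D \<in> carrier_vec D"
    and "\<And>N D. (N, D) \<in> ratio_pairs lam \<Longrightarrow> gaussian_vector (M N D) N (w N D)"
    and "\<And>N D. (N, D) \<in> ratio_pairs lam \<Longrightarrow> indep_mat_vec (M N D) N D (X N D) (w N D)"
    and "\<And>N D s. (N, D) \<in> ratio_pairs lam \<Longrightarrow> s \<in> space (M N D) \<Longrightarrow>
           y N D s = X N D s *\<^sub>v theta N D + w N D s"
  shows "\<exists>e :: nat \<times> nat \<Rightarrow> real. e \<in> o[ratio_filter lam](\<lambda>_. 1) \<and>
           (\<forall>(N, D) \<in> ratio_pairs lam.
              (\<integral>s. l2_norm (pinv (X N D s) *\<^sub>v y N D s - pinv (X N D s) *\<^sub>v (X N D s *\<^sub>v theta N D)) \<partial>M N D)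
                = (1 + e (N, D)) * sqrt (real N / (real D - real N)))"
proof -
  define c where "c = sqrt (lam / (1 - lam))"
  have c: "0 < c" and c2: "c\<^sup>2 = lam / (1 - lam)" using assms(1,2) by (auto simp: c_def)
  \<comment> \<open>Since lam is the limit of N / (D + 1), both moment bounds become sharp at the
    same value c.\<close>
  have lam: "c\<^sup>2 / (1 + c\<^sup>2) = lam" using assms(1,2) unfolding c2 by (simp add: field_simps)
  define V where "V N D = (\<integral>g. pinv_norm N D g \<partial>gauss ({..<N} \<times> {..<Suc D}))" for N D
  \<comment> \<open>The relative error is taken as the definition of e, so the required equation
    holds for every pair, however small D is, and only e \<rightarrow> 0 needs the
    estimates.\<close>
  define e where "e = (\<lambda>(N, D). V N D / c - 1)"
  have N: "real N = lam * real D" "0 < N" "0 < D" if "(N, D) \<in> ratio_pairs lam" for N D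
    using that by (auto simp: ratio_pairs_def)
  \<comment> \<open>Along a fixed ratio the target is the constant c, so convergence of V to c is
    all that remains.\<close>
  have c_eq: "sqrt (real N / (real D - real N)) = c" if "(N, D) \<in> ratio_pairs lam" for N D
  proof -
    have "real N / (real D - real N) = (lam * real D) / ((1 - lam) * real D)"
      using N(1)[OF that] by (simp add: algebra_simps)
    then show ?thesis using N(3)[OF that] by (simp add: c_def)
  qed
  have eq: "(\<integral>s. l2_norm (pinv (X N D s) *\<^sub>v y N D s - pinv (X N D s) *\<^sub>v (X N D s *\<^sub>v theta N D)) \<partial>M N D)
      = (1 + e (N, D)) * sqrt (real N / (real D - real N))" if p: "(N, D) \<in> ratio_pairs lam" for N D
    using expectation_pinv_eq[OF assms(3)[OF p] N(2,3)[OF p] assms(4)[OF p] assms(6)[OF p] assms(7)[OF p] assms(5)[OF p] assms(8)[OF p]]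
    using c by (simp add: c_eq[OF p] e_def V_def)
  define m where "m = min 1 (c\<^sup>2)"
  define a where "a D = lam * real D / ((1 - lam) * real D - 1)" for D :: nat
  define b where "b D = lam * real D / (real D + 1)" for D :: nat
  define up where "up D = c + (a D - c\<^sup>2) / (2 * c)" for D
  define lo where "lo D = c + (1 - 1 / m) / (2 * c) * (a D - c\<^sup>2) + (1 + c\<^sup>2)\<^sup>2 / (2 * c * m) * (b D - lam)" for D
  have "a \<longlonglongrightarrow> lam * inverse (1 - lam)"
    unfolding a_def using assms(1,2) by real_asymp
  then have a_lim: "a \<longlonglongrightarrow> c\<^sup>2" by (simp add: c2 divide_inverse)
  have b_lim: "b \<longlonglongrightarrow> lam"
    unfolding b_def using assms(1) by real_asymp
  have up_lim: "up \<longlonglongrightarrow> c + (c\<^sup>2 - c\<^sup>2) / (2 * c)"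
    unfolding up_def using c by (intro tendsto_intros a_lim) auto
  have lo_lim: "lo \<longlonglongrightarrow> c + (1 - 1 / m) / (2 * c) * (c\<^sup>2 - c\<^sup>2) + (1 + c\<^sup>2)\<^sup>2 / (2 * c * m) * (lam - lam)"
    unfolding lo_def by (intro tendsto_intros a_lim b_lim)
  \<comment> \<open>The condition on D says N + 1 < D, which both moment bounds require; it holds
    for all large D because lam < 1.\<close>
  have bounds: "lo D \<le> V N D \<and> V N D \<le> up D" if p: "(N, D) \<in> ratio_pairs lam" and D: "1 < (1 - lam) * real D" for N D
  proof -
    have ND: "N + 1 < D" using D N(1)[OF p] by (simp add: algebra_simps)
    have a: "real N / (real D - real N - 1) = a D" and b: "real N / (real D + 1) = b D"
      using N(1)[OF p] by (simp_all add: a_def b_def algebra_simps)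
    let ?J = "{..<N} \<times> {..<Suc D}"
    note B = prob_space_expectation_bounds[OF prob_space_gauss c pinv_norm_measurable[of N D ?J] pinv_norm_nonneg
        integral_pinv_norm_sq_le[OF ND] integral_pinv_norm_ratio_ge[OF ND]]
    show ?thesis using B unfolding a b lam m_def[symmetric] lo_def up_def V_def by simp
  qed
  have ev: "\<forall>\<^sub>F p in ratio_filter lam. lo (snd p) \<le> V (fst p) (snd p) \<and> V (fst p) (snd p) \<le> up (snd p)"
  proof -
    have "\<forall>\<^sub>F D in sequentially. 1 < (1 - lam) * real D" using assms(2) by real_asymp
    then have "\<forall>\<^sub>F p in ratio_filter lam. 1 < (1 - lam) * real (snd p)"
      using ratio_filter_snd[of lam] by (rule eventually_compose_filterlim)
    moreover have "\<forall>\<^sub>F p in ratio_filter lam. p \<in> ratio_pairs lam"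
      by (simp add: ratio_filter_def eventually_inf_principal)
    ultimately show ?thesis by eventually_elim (use bounds in auto)
  qed
  have "((\<lambda>p. V (fst p) (snd p)) \<longlongrightarrow> c) (ratio_filter lam)"
  proof (rule tendsto_sandwich)
    show "\<forall>\<^sub>F p in ratio_filter lam. lo (snd p) \<le> V (fst p) (snd p)" using ev by eventually_elim simp
    show "\<forall>\<^sub>F p in ratio_filter lam. V (fst p) (snd p) \<le> up (snd p)" using ev by eventually_elim simp
    show "((\<lambda>p. lo (snd p)) \<longlongrightarrow> c) (ratio_filter lam)"
      using filterlim_compose[OF lo_lim ratio_filter_snd] by simp
    show "((\<lambda>p. up (snd p)) \<longlongrightarrow> c) (ratio_filter lam)"
      using filterlim_compose[OF up_lim ratio_filter_snd] by simp
  qed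
  then have "((\<lambda>p. V (fst p) (snd p) / c - 1) \<longlongrightarrow> c / c - 1) (ratio_filter lam)"
    using c by (intro tendsto_intros) auto
  then have "(e \<longlongrightarrow> 0) (ratio_filter lam)"
    using c by (simp add: e_def case_prod_unfold)
  then have "e \<in> o[ratio_filter lam](\<lambda>_. 1)"
    by (intro smalloI_tendsto) auto
  then show ?thesis using eq by blast
qed

end
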